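(* There exist absolute constants $c, C > 0$ such that the following holds for all integers $1 \le k \le n$. Let $K$ and $L$ be symmetric convex bodies in $\mathbb{R}^n$. Assume that $K$ has a section of dimension at least $k$ whose diameter is bounded by $1$, and that $L$ has a section of dimension at least $n - ck$ whose diameter is bounded by $1$. Then for a random orthogonal operator $U \in \mathcal{O}(n)$, the body $K \cap UL$ has diameter at most $C^{n/k}$ with probability at least $1 - e^{-n}$.
   Context: A convex body $K \subset \mathbb{R}^n$ is symmetric if $K = -K$. A section of $K$ of dimension $m$ is a set $K \cap E$, where $E$ is an $m$-dimensional linear subspace of $\mathbb{R}^n$. Diameters are with respect to the Euclidean norm. $\mathcal{O}(n)$ is the orthogonal group of $\mathbb{R}^n$, and a random $U \in \mathcal{O}(n)$ is distributed according to the normalized Haar measure. "Absolute constant" means a number independent of $n, k, K, L$. *)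

theory Defs
  imports "HOL-Probability.Probability" "HOL-Library.Function_Algebras"
begin

text \<open>
  The constants of the theorem do not depend on the dimension \<open>n\<close>, so \<open>n\<close> has to be a number and not
  a type: \<open>\<real>\<^sup>n\<close> is the space \<^const>\<open>Euclidean_space\<close> \<open>n\<close> of the library, whose points are the functions
  \<open>x :: nat \<Rightarrow> real\<close> with \<open>x i = 0\<close> for \<open>i \<ge> n\<close>. The pointwise vector space structure makes
  \<^const>\<open>subspace\<close>, \<^const>\<open>dim\<close> and \<^const>\<open>convex\<close> available for these functions.
\<close>

instantiation "fun" :: (type, real_vector) real_vector
begin

definition scaleR_fun :: "real \<Rightarrow> ('a \<Rightarrow> 'b) \<Rightarrow> 'a \<Rightarrow> 'b"
  where "scaleR_fun r f = (\<lambda>x. r *\<^sub>R f x)"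

instance
  by standard (auto simp: scaleR_fun_def fun_eq_iff scaleR_add_left scaleR_add_right)

end

definition is_subspace_of_dim :: "nat \<Rightarrow> nat \<Rightarrow> (nat \<Rightarrow> real) set \<Rightarrow> bool"
  where "is_subspace_of_dim n m E \<longleftrightarrow>
    E \<subseteq> topspace (Euclidean_space n) \<and> subspace E \<and> dim E = m"

definition is_section :: "nat \<Rightarrow> nat \<Rightarrow> (nat \<Rightarrow> real) set \<Rightarrow> (nat \<Rightarrow> real) set \<Rightarrow> bool"
  where "is_section n m K S \<longleftrightarrow> (\<exists>E. is_subspace_of_dim n m E \<and> S = K \<inter> E)"

definition convex_body :: "nat \<Rightarrow> (nat \<Rightarrow> real) set \<Rightarrow> bool"
  where "convex_body n K \<longleftrightarrow>
    convex K \<and> compactin (Euclidean_space n) K \<and> Euclidean_space n interior_of K \<noteq> {}"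

definition symmetric_set :: "(nat \<Rightarrow> real) set \<Rightarrow> bool"
  where "symmetric_set K \<longleftrightarrow> K = uminus ` K"

text \<open>
  The type class \<^class>\<open>metric_space\<close> puts a different, non-Euclidean metric on \<open>nat \<Rightarrow> real\<close>, so the
  library's \<^const>\<open>dist\<close> and \<^const>\<open>diameter\<close> cannot be used here. The supremum is
  meaningful for bounded sets only; it is applied to subsets of convex bodies.
\<close>

definition euclid_dist :: "nat \<Rightarrow> (nat \<Rightarrow> real) \<Rightarrow> (nat \<Rightarrow> real) \<Rightarrow> real"
  where "euclid_dist n x y = L2_set (\<lambda>i. x i - y i) {..<n}"

definition euclid_diameter :: "nat \<Rightarrow> (nat \<Rightarrow> real) set \<Rightarrow> real"
  where "euclid_diameter n S = (if S = {} then 0 else SUP (x, y)\<in>S \<times> S. euclid_dist n x y)"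

text \<open>
  An \<open>n \<times> n\<close> matrix is a function \<open>nat \<Rightarrow> nat \<Rightarrow> real\<close> whose entries outside of the first \<open>n\<close> rows and
  columns vanish. Such matrices form a copy of \<open>\<real>\<^bsup>n\<times>n\<^esup>\<close>, with the usual topology.
\<close>

definition square_matrices :: "nat \<Rightarrow> (nat \<Rightarrow> nat \<Rightarrow> real) set"
  where "square_matrices n = {A. \<forall>i j. i \<ge> n \<or> j \<ge> n \<longrightarrow> A i j = 0}"

definition mat_vec :: "nat \<Rightarrow> (nat \<Rightarrow> nat \<Rightarrow> real) \<Rightarrow> (nat \<Rightarrow> real) \<Rightarrow> nat \<Rightarrow> real"
  where "mat_vec n A x = (\<lambda>i. \<Sum>j<n. A i j * x j)"

definition mat_mult ::
    "nat \<Rightarrow> (nat \<Rightarrow> nat \<Rightarrow> real) \<Rightarrow> (nat \<Rightarrow> nat \<Rightarrow> real) \<Rightarrow> nat \<Rightarrow> nat \<Rightarrow> real"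
  where "mat_mult n A B = (\<lambda>i j. \<Sum>l<n. A i l * B l j)"

definition mat_one :: "nat \<Rightarrow> nat \<Rightarrow> nat \<Rightarrow> real"
  where "mat_one n = (\<lambda>i j. if i = j \<and> i < n then 1 else 0)"

definition orthogonal_group :: "nat \<Rightarrow> (nat \<Rightarrow> nat \<Rightarrow> real) set"
  where "orthogonal_group n =
    {A \<in> square_matrices n. mat_mult n (\<lambda>i j. A j i) A = mat_one n}"

text \<open>
  The normalized Haar measure, characterized as the Borel probability measure on the orthogonal
  group that is invariant under left translations.
\<close>

definition normalized_haar :: "nat \<Rightarrow> (nat \<Rightarrow> nat \<Rightarrow> real) measure \<Rightarrow> bool"
  where "normalized_haar n M \<longleftrightarrow>
    prob_space M \<and>
    sets M = sets (restrict_space borel (orthogonal_group n)) \<and>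
    (\<forall>A \<in> orthogonal_group n. distr M M (mat_mult n A) = M)"

text \<open>Left translations are measurable, so the push-forward above is the intended one.\<close>

lemma mat_mult_orthogonal_group:
  assumes "A \<in> orthogonal_group n" "B \<in> orthogonal_group n"
  shows "mat_mult n A B \<in> orthogonal_group n"
proof -
  have A: "\<And>i j. i \<ge> n \<or> j \<ge> n \<Longrightarrow> A i j = 0" and B: "\<And>i j. i \<ge> n \<or> j \<ge> n \<Longrightarrow> B i j = 0"
    using assms by (auto simp: orthogonal_group_def square_matrices_def)
  have AA: "(\<Sum>l<n. A l i * A l j) = mat_one n i j"
    and BB: "(\<Sum>l<n. B l i * B l j) = mat_one n i j" for i j
    using assms by (auto simp: orthogonal_group_def mat_mult_def fun_eq_iff)
  have "(\<Sum>l<n. (\<Sum>p<n. A l p * B p i) * (\<Sum>q<n. A l q * B q j)) = mat_one n i j" for i j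
  proof -
    have "(\<Sum>l<n. (\<Sum>p<n. A l p * B p i) * (\<Sum>q<n. A l q * B q j))
        = (\<Sum>l<n. \<Sum>p<n. \<Sum>q<n. (B p i * B q j) * (A l p * A l q))"
      by (simp add: sum_product mult_ac)
    also have "\<dots> = (\<Sum>p<n. \<Sum>l<n. \<Sum>q<n. (B p i * B q j) * (A l p * A l q))"
      by (rule sum.swap)
    also have "\<dots> = (\<Sum>p<n. \<Sum>q<n. \<Sum>l<n. (B p i * B q j) * (A l p * A l q))"
      by (intro sum.cong refl sum.swap)
    also have "\<dots> = (\<Sum>p<n. \<Sum>q<n. (B p i * B q j) * mat_one n p q)"
      by (simp flip: sum_distrib_left add: AA)
    also have "\<dots> = (\<Sum>p<n. \<Sum>q<n. if p = q then B p i * B q j else 0)"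
      by (intro sum.cong) (auto simp: mat_one_def)
    also have "\<dots> = (\<Sum>p<n. B p i * B p j)"
      by simp
    finally show ?thesis
      by (simp add: BB)
  qed
  then show ?thesis
    using A B by (auto simp: orthogonal_group_def square_matrices_def mat_mult_def fun_eq_iff)
qed

lemma measurable_mat_mult:
  assumes "sets M = sets (restrict_space borel (orthogonal_group n))" "A \<in> orthogonal_group n"
  shows "mat_mult n A \<in> measurable M M"
proof -
  have "continuous_on UNIV (mat_mult n A)"
    unfolding mat_mult_def
    by (intro continuous_on_coordinatewise_then_product continuous_intros
        continuous_on_product_coordinates
        continuous_on_product_then_coordinatewise[OF continuous_on_product_coordinates])
  then have "mat_mult n A \<in> borel_measurable borel"
    by (rule borel_measurable_continuous_onI)
  then have "mat_mult n A \<in> measurable (restrict_space borel (orthogonal_group n))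
      (restrict_space borel (orthogonal_group n))"
    using assms(2)
    by (intro measurable_restrict_space2 measurable_restrict_space1)
      (auto simp: space_restrict_space mat_mult_orthogonal_group)
  then show ?thesis
    using measurable_cong_sets[OF assms(1) assms(1)] by simp
qed

end

theory Submission
  imports Defs
begin

text \<open>
  The proof is a union bound over nets, and every estimate in it is a comparison of volumes.
  Fix a radius \<open>R = 160000\<^bsup>n/k\<^esup>\<close>. If \<open>K \<inter> UL\<close> contains a vector longer than \<open>R\<close>, then by
  convexity it contains one of length exactly \<open>R\<close>, that is, \<open>U\<close> maps a point of \<open>L \<inter> RS\<close> to a point
  of \<open>K \<inter> RS\<close>, where \<open>RS\<close> is the sphere of radius \<open>R\<close>.

  A bounded section makes a symmetric convex body small in the sense of covering numbers: if \<open>K \<inter> E\<close>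
  lies in the ball of radius \<open>1/2\<close> and \<open>dim E = d\<close>, then the part of \<open>K\<close> in the ball of radius \<open>R\<close>
  is covered by \<open>(1 + 2R)\<^bsup>n-d\<^esup>\<close> balls of radius \<open>3\<close> (\<open>covering_by_section\<close>). So \<open>K \<inter> RS\<close> and
  \<open>L \<inter> RS\<close> have nets of sizes at most \<open>(1 + 2R)\<^bsup>n-k\<^esup>\<close> and \<open>(1 + 2R)\<^bsup>ck\<^esup>\<close>. If \<open>U\<close> maps a point of \<open>L \<inter> RS\<close>
  into \<open>K \<inter> RS\<close>, then it maps a point \<open>y\<close> of the second net to within \<open>6\<close> of a point \<open>x\<close> of the first.
  Since \<open>Uy\<close> is uniformly distributed on a sphere, this has probability at most \<open>13\<^sup>n / R\<^bsup>n-1\<^esup>\<close> for each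
  pair \<open>(x, y)\<close> (\<open>measure_hit_event_le\<close>).

  Altogether the probability of failure is at most \<open>A\<^sup>n R\<^bsup>1-k+ck\<^esup>\<close> for an absolute constant \<open>A\<close>. With
  \<open>c = 1/4\<close> and \<open>k \<ge> 4\<close> the exponent of \<open>R\<close> is at most \<open>-k/2\<close>, so that \<open>R\<^bsup>-k/2\<^esup> = 400\<^bsup>-n\<^esup>\<close> outweighs
  \<open>A\<^sup>n\<close> (\<open>covering_bound_le_exp\<close>). If \<open>k < 4\<close>, then the section of \<open>L\<close> has codimension less than \<open>1\<close>:
  it is \<open>L\<close> itself, and \<open>K \<inter> UL\<close> lies in the ball of radius \<open>1/2\<close> for every \<open>U\<close>.
\<close>

section \<open>Lebesgue measure on the coordinate space\<close>

abbreviation euclidean_carrier :: "nat \<Rightarrow> (nat \<Rightarrow> real) set"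
  where "euclidean_carrier n \<equiv> topspace (Euclidean_space n)"

lemma in_carrier_iff: "x \<in> euclidean_carrier n \<longleftrightarrow> (\<forall>i\<ge>n. x i = 0)"
  by (simp add: topspace_Euclidean_space)

lemma scaleR_fun_apply [simp]: "(c *\<^sub>R x) i = c *\<^sub>R x i"
  by (simp add: scaleR_fun_def)

lemma subspace_carrier: "subspace (euclidean_carrier n)"
  by (auto simp: subspace_def in_carrier_iff)

lemma measurable_carrier [measurable]: "euclidean_carrier n \<in> sets borel"
  using closedin_Euclidean_space[of n]
  by (simp add: euclidean_product_topology borel_closed flip: closed_closedin)

definition zero_extend :: "nat \<Rightarrow> (nat \<Rightarrow> real) \<Rightarrow> nat \<Rightarrow> real"
  where "zero_extend n f = (\<lambda>i. if i < n then f i else 0)"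

text \<open>
  Lebesgue measure of \<open>\<real>\<^sup>n\<close>, as a Borel measure on all functions \<open>nat \<Rightarrow> real\<close>. The product measure
  lives on functions that are undefined outside of \<open>{..<n}\<close>; the push-forward moves it to
  functions that vanish there.
\<close>

definition vol :: "nat \<Rightarrow> (nat \<Rightarrow> real) measure"
  where "vol n = distr (Pi\<^sub>M {..<n} (\<lambda>_. lborel)) borel (zero_extend n)"

lemma sets_vol [measurable_cong, simp]: "sets (vol n) = sets borel"
  and space_vol [simp]: "space (vol n) = UNIV"
  by (simp_all add: vol_def)

lemma measurable_to_fun_borel:
  fixes f :: "'a \<Rightarrow> nat \<Rightarrow> real"
  assumes "\<And>i. (\<lambda>x. f x i) \<in> borel_measurable M"
  shows "f \<in> measurable M borel"
proof -
  have "f \<in> measurable M (Pi\<^sub>M UNIV (\<lambda>_. borel))"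
    by (rule measurable_PiM_single') (use assms in auto)
  then show ?thesis
    using measurable_cong_sets[OF refl sets_PiM_equal_borel] by blast
qed

lemma measurable_zero_extend [measurable]:
  "zero_extend n \<in> measurable (Pi\<^sub>M {..<n} (\<lambda>_. lborel)) borel"
proof (rule measurable_to_fun_borel)
  show "(\<lambda>x. zero_extend n x i) \<in> borel_measurable (Pi\<^sub>M {..<n} (\<lambda>_. lborel))" for i
    by (cases "i < n") (simp_all add: zero_extend_def)
qed

lemma measurable_affine [measurable]:
  "(\<lambda>x. a + c *\<^sub>R x) \<in> measurable borel (borel :: (nat \<Rightarrow> real) measure)"
  by (rule measurable_to_fun_borel) simp

lemma product_sigma_finite_lborel: "product_sigma_finite (\<lambda>i::nat. lborel :: real measure)"
  by (simp add: product_sigma_finite_def sigma_finite_lborel)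

lemma emeasure_lborel_affine:
  assumes "c > 0" "A \<in> sets borel"
  shows "ennreal c * emeasure lborel ((\<lambda>t. a + c * t) -` A) = emeasure lborel (A :: real set)"
proof -
  have "emeasure lborel A = emeasure (density (distr lborel borel (\<lambda>x. a + c * x)) (\<lambda>_. ennreal \<bar>c\<bar>)) A"
    using lborel_real_affine[of c a] assms by simp
  also have "\<dots> = ennreal c * emeasure lborel ((\<lambda>t. a + c * t) -` A)"
    using assms by (simp add: emeasure_density nn_integral_cmult emeasure_distr)
  finally show ?thesis by simp
qed

text \<open>
  Both sides agree on products of Borel sets, by the transformation rule in each coordinate.
\<close>

lemma PiM_lborel_affine:
  assumes c: "c > 0"
  shows "scale_measure (ennreal (c ^ n))
      (distr (Pi\<^sub>M {..<n} (\<lambda>_. lborel)) (Pi\<^sub>M {..<n} (\<lambda>_. lborel)) (\<lambda>f. \<lambda>i\<in>{..<n}. a i + c * f i))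
    = Pi\<^sub>M {..<n} (\<lambda>_. lborel)"
proof -
  interpret product_sigma_finite "\<lambda>i::nat. lborel :: real measure"
    by (rule product_sigma_finite_lborel)
  let ?P = "Pi\<^sub>M {..<n} (\<lambda>_. lborel :: real measure)"
  let ?T = "\<lambda>f. \<lambda>i\<in>{..<n}. a i + c * f i"
  have T: "?T \<in> measurable ?P ?P"
    by (intro measurable_restrict) simp
  show ?thesis
  proof (rule PiM_eqI)
    fix A :: "nat \<Rightarrow> real set"
    assume A: "\<And>i. i \<in> {..<n} \<Longrightarrow> A i \<in> sets lborel"
    have "?T -` Pi\<^sub>E {..<n} A \<inter> space ?P = Pi\<^sub>E {..<n} (\<lambda>i. (\<lambda>t. a i + c * t) -` A i)"
      by (auto simp: space_PiM PiE_def Pi_def)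
    moreover have "(\<lambda>t. a i + c * t) -` A i \<in> sets borel" if "i < n" for i
      using measurable_sets[of "\<lambda>t. a i + c * t" borel borel "A i"] A that by simp
    ultimately have "emeasure (distr ?P ?P ?T) (Pi\<^sub>E {..<n} A)
        = (\<Prod>i<n. emeasure lborel ((\<lambda>t. a i + c * t) -` A i))"
      using A by (subst emeasure_distr[OF T]) (auto intro!: emeasure_PiM sets_PiM_I_finite)
    then have "ennreal (c ^ n) * emeasure (distr ?P ?P ?T) (Pi\<^sub>E {..<n} A)
        = (\<Prod>i<n. ennreal c * emeasure lborel ((\<lambda>t. a i + c * t) -` A i))"
      using c by (simp add: prod.distrib ennreal_power)
    also have "\<dots> = (\<Prod>i<n. emeasure lborel (A i))"
      using A c by (intro prod.cong emeasure_lborel_affine) auto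
    finally show "emeasure (scale_measure (ennreal (c ^ n)) (distr ?P ?P ?T)) (Pi\<^sub>E {..<n} A)
        = (\<Prod>i<n. emeasure lborel (A i))"
      by simp
  qed simp_all
qed

text \<open>
  The scaling and translation behaviour of volume is the only property of Lebesgue measure, beyond
  its being finite and positive on suitable sets, that the covering arguments use. Stating it for
  preimages avoids a separate measurability argument for images.
\<close>

lemma emeasure_vol_affine:
  assumes c: "c > 0" and a: "a \<in> euclidean_carrier n" and A: "A \<in> sets borel"
  shows "ennreal (c ^ n) * emeasure (vol n) ((\<lambda>x. a + c *\<^sub>R x) -` A) = emeasure (vol n) A"
proof -
  let ?P = "Pi\<^sub>M {..<n} (\<lambda>_. lborel :: real measure)"
  let ?T = "\<lambda>f. \<lambda>i\<in>{..<n}. a i + c * f i"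
  let ?B = "zero_extend n -` A \<inter> space ?P"
  have T: "?T \<in> measurable ?P ?P"
    by (intro measurable_restrict) simp
  have B: "?B \<in> sets ?P"
    using A by (intro measurable_sets[OF measurable_zero_extend]) simp
  have g: "(\<lambda>x. a + c *\<^sub>R x) -` A \<in> sets borel"
    using measurable_sets[OF measurable_affine A] by simp
  have *: "zero_extend n (?T f) = a + c *\<^sub>R zero_extend n f" for f
    using a by (auto simp: zero_extend_def in_carrier_iff fun_eq_iff)
  have "emeasure (vol n) A = emeasure ?P ?B"
    using A by (simp add: vol_def emeasure_distr)
  also have "\<dots> = emeasure (scale_measure (ennreal (c ^ n)) (distr ?P ?P ?T)) ?B"
    by (simp only: PiM_lborel_affine[OF c])
  also have "\<dots> = ennreal (c ^ n) * emeasure ?P (?T -` ?B \<inter> space ?P)"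
    using B by (simp add: emeasure_distr[OF T])
  also have "?T -` ?B \<inter> space ?P = zero_extend n -` ((\<lambda>x. a + c *\<^sub>R x) -` A) \<inter> space ?P"
    using measurable_space[OF T] * by auto
  also have "emeasure ?P \<dots> = emeasure (vol n) ((\<lambda>x. a + c *\<^sub>R x) -` A)"
    using g by (simp add: vol_def emeasure_distr)
  finally show ?thesis by simp
qed

definition cube :: "nat \<Rightarrow> real \<Rightarrow> (nat \<Rightarrow> real) set"
  where "cube n r = {x \<in> euclidean_carrier n. \<forall>i<n. \<bar>x i\<bar> \<le> r}"

lemma measurable_cube [measurable]: "cube n r \<in> sets borel"
proof -
  have "{x :: nat \<Rightarrow> real. \<forall>i<n. \<bar>x i\<bar> \<le> r} \<in> sets borel"
    by measurable
  moreover have "cube n r = euclidean_carrier n \<inter> {x. \<forall>i<n. \<bar>x i\<bar> \<le> r}"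
    by (auto simp: cube_def)
  ultimately show ?thesis
    using sets.Int[OF measurable_carrier] by simp
qed

lemma emeasure_vol_cube:
  assumes "r \<ge> 0"
  shows "emeasure (vol n) (cube n r) = ennreal ((2 * r) ^ n)"
proof -
  interpret product_sigma_finite "\<lambda>i::nat. lborel :: real measure"
    by (rule product_sigma_finite_lborel)
  let ?P = "Pi\<^sub>M {..<n} (\<lambda>_. lborel :: real measure)"
  have "\<bar>t\<bar> \<le> r \<longleftrightarrow> t \<in> {-r..r}" for t
    by auto
  then have "zero_extend n f \<in> cube n r \<longleftrightarrow> (\<forall>i<n. f i \<in> {-r..r})" for f
    by (simp add: zero_extend_def cube_def in_carrier_iff)
  then have "zero_extend n -` cube n r \<inter> space ?P = Pi\<^sub>E {..<n} (\<lambda>_. {-r..r})"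
    unfolding space_PiM by (auto simp: PiE_def Pi_def)
  then have "emeasure (vol n) (cube n r) = emeasure ?P (Pi\<^sub>E {..<n} (\<lambda>_. {-r..r}))"
    by (simp add: vol_def emeasure_distr)
  also have "\<dots> = (\<Prod>i<n. emeasure lborel {-r..r})"
    by (rule emeasure_PiM) auto
  finally show ?thesis
    using assms by (simp add: ennreal_power)
qed

lemma measure_vol_affine:
  assumes "c > 0" "a \<in> euclidean_carrier n" "A \<in> sets borel"
  shows "c ^ n * measure (vol n) ((\<lambda>x. a + c *\<^sub>R x) -` A) = measure (vol n) A"
  using arg_cong[OF emeasure_vol_affine[OF assms], of enn2real] assms(1)
  by (simp add: measure_def enn2real_mult)

lemma fmeasurable_vol:
  assumes "A \<in> sets borel" "A \<subseteq> cube n r"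
  shows "A \<in> fmeasurable (vol n)"
proof (rule fmeasurableI2)
  have "cube n r \<subseteq> cube n (max r 0)" by (auto simp: cube_def)
  then show "A \<subseteq> cube n (max r 0)" using assms by auto
  show "cube n (max r 0) \<in> fmeasurable (vol n)"
    using emeasure_vol_cube[of "max r 0" n] by (intro fmeasurableI) auto
qed (use assms in auto)

lemma measure_vol_pos:
  assumes "A \<in> fmeasurable (vol n)" "cube n r \<subseteq> A" "r > 0"
  shows "measure (vol n) A > 0"
proof -
  have "0 < measure (vol n) (cube n r)"
    using emeasure_vol_cube[of r n] assms by (simp add: measure_def)
  also have "\<dots> \<le> measure (vol n) A"
    using assms by (intro measure_mono_fmeasurable) auto
  finally show ?thesis .
qed

section \<open>The Euclidean norm and volumetric packing bounds\<close>

definition enorm :: "nat \<Rightarrow> (nat \<Rightarrow> real) \<Rightarrow> real"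
  where "enorm n x = L2_set x {..<n}"

lemma enorm_nonneg [simp]: "0 \<le> enorm n x"
  by (simp add: enorm_def L2_set_nonneg)

lemma enorm_zero [simp]: "enorm n 0 = 0"
  by (simp add: enorm_def L2_set_def)

lemma enorm_triangle: "enorm n (x + y) \<le> enorm n x + enorm n y"
  using L2_set_triangle_ineq[of x y "{..<n}"] by (simp add: enorm_def plus_fun_def)

lemma enorm_scaleR: "enorm n (c *\<^sub>R x) = \<bar>c\<bar> * enorm n x"
proof -
  have "enorm n (c *\<^sub>R x) = sqrt (c\<^sup>2 * (\<Sum>i<n. (x i)\<^sup>2))"
    by (simp add: enorm_def L2_set_def power_mult_distrib sum_distrib_left)
  then show ?thesis
    by (simp add: real_sqrt_mult enorm_def L2_set_def)
qed

lemma enorm_minus: "enorm n (- x) = enorm n x"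
  using enorm_scaleR[of n "-1" x] by simp

lemma enorm_minus_commute: "enorm n (x - y) = enorm n (y - x)"
  using enorm_minus[of n "x - y"] by simp

lemma enorm_triangle_sub: "enorm n (x - z) \<le> enorm n (x - y) + enorm n (y - z)"
  using enorm_triangle[of n "x - y" "y - z"] by simp

lemma enorm_sq: "(enorm n x)\<^sup>2 = (\<Sum>i<n. (x i)\<^sup>2)"
  by (simp add: enorm_def L2_set_def sum_nonneg)

lemma abs_coord_le_enorm: "i < n \<Longrightarrow> \<bar>x i\<bar> \<le> enorm n x"
  using member_le_L2_set[of "{..<n}" i x]
  by (simp add: enorm_def L2_set_def)
    (smt (verit) real_sqrt_abs real_sqrt_le_mono member_le_sum finite_lessThan lessThan_iff zero_le_power2)

lemma enorm_le_sum: "enorm n x \<le> (\<Sum>i<n. \<bar>x i\<bar>)"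
  by (simp add: enorm_def L2_set_le_sum_abs)

lemma continuous_on_coord:
  fixes f :: "'a::topological_space \<Rightarrow> nat \<Rightarrow> real"
  shows "continuous_on S f \<Longrightarrow> continuous_on S (\<lambda>x. f x i)"
  by (rule continuous_on_product_then_coordinatewise)

lemma continuous_on_enorm [continuous_intros]:
  fixes f :: "'a::topological_space \<Rightarrow> nat \<Rightarrow> real"
  assumes "continuous_on S f"
  shows "continuous_on S (\<lambda>x. enorm n (f x))"
  unfolding enorm_def L2_set_def
  by (intro continuous_on_real_sqrt continuous_on_sum continuous_on_power continuous_on_coord assms)

lemma convex_symmetric_combination:
  assumes "convex D" "symmetric_set D" "x \<in> D" "y \<in> D" "\<bar>a\<bar> + \<bar>b\<bar> \<le> 1"
  shows "a *\<^sub>R x + b *\<^sub>R y \<in> D"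
proof -
  have neg: "- z \<in> D" if "z \<in> D" for z
    using assms(2) that unfolding symmetric_set_def by blast
  have "(1/2) *\<^sub>R x + (1/2) *\<^sub>R (- x) \<in> D"
    using assms neg by (intro convexD) auto
  then have zero: "0 \<in> D" by simp
  have scale: "t *\<^sub>R z \<in> D" if "z \<in> D" "0 \<le> t" "t \<le> 1" for t z
    using convexD[OF assms(1) that(1) zero, of t "1 - t"] that by simp
  obtain x' where x': "x' \<in> D" "\<bar>a\<bar> *\<^sub>R x' = a *\<^sub>R x"
    using neg[OF assms(3)] assms(3) by (cases "a \<ge> 0") force+
  obtain y' where y': "y' \<in> D" "\<bar>b\<bar> *\<^sub>R y' = b *\<^sub>R y"
    using neg[OF assms(4)] assms(4) by (cases "b \<ge> 0") force+
  define s where "s = \<bar>a\<bar> + \<bar>b\<bar>"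
  show ?thesis
  proof (cases "s = 0")
    case True
    then have "a = 0" "b = 0" by (simp_all add: s_def add_nonneg_eq_0_iff)
    then show ?thesis using zero by simp
  next
    case False
    then have s: "s > 0" "s \<le> 1" using assms by (auto simp: s_def)
    have "(\<bar>a\<bar> / s) *\<^sub>R x' + (\<bar>b\<bar> / s) *\<^sub>R y' \<in> D"
      using s x' y' assms(1) by (intro convexD) (auto simp: s_def simp flip: add_divide_distrib)
    then have "s *\<^sub>R ((\<bar>a\<bar> / s) *\<^sub>R x' + (\<bar>b\<bar> / s) *\<^sub>R y') \<in> D"
      using s by (intro scale) auto
    then show ?thesis
      using s x' y' by (simp add: scaleR_add_right)
  qed
qed

lemma convex_symmetric_scale:
  assumes "convex D" "symmetric_set D" "x \<in> D" "\<bar>a\<bar> \<le> 1"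
  shows "a *\<^sub>R x \<in> D"
  using convex_symmetric_combination[OF assms(1,2,3,3), of a 0] assms(4) by simp

text \<open>
  The volumetric bound on separated sets for the norm whose unit ball is \<open>D\<close>: the bodies
  \<open>x + (\<eta>/2) D\<close> for \<open>x \<in> X\<close> are disjoint and contained in \<open>(1 + \<eta>/2) D\<close>.
\<close>

lemma card_separated_le:
  assumes D: "D \<in> sets borel" "convex D" "symmetric_set D"
    and bounds: "D \<subseteq> cube n r" "cube n e \<subseteq> D" "e > 0"
    and eta: "\<eta> > 0"
    and X: "finite X" "X \<subseteq> D"
    and sep: "\<And>x y. x \<in> X \<Longrightarrow> y \<in> X \<Longrightarrow> x \<noteq> y \<Longrightarrow> (1 / \<eta>) *\<^sub>R (x - y) \<notin> D"
  shows "real (card X) \<le> (1 + 2 / \<eta>) ^ n"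
proof -
  let ?V = "measure (vol n)"
  define B where "B x = (\<lambda>z. (- (2 / \<eta>)) *\<^sub>R x + (2 / \<eta>) *\<^sub>R z) -` D" for x
  define W where "W = (\<lambda>z. 0 + (1 / (1 + \<eta> / 2)) *\<^sub>R z) -` D"
  have carrier: "x \<in> euclidean_carrier n" if "x \<in> D" for x
    using bounds that by (auto simp: cube_def)
  have BW_sets: "B x \<in> sets borel" "W \<in> sets borel" for x
    unfolding B_def W_def using measurable_sets[OF measurable_affine D(1)]
    by (simp_all only: space_borel Int_UNIV_right)
  have V: "?V D > 0"
    using measure_vol_pos[OF fmeasurable_vol[OF D(1) bounds(1)] bounds(2,3)] .
  have VW: "?V W = (1 + \<eta> / 2) ^ n * ?V D"
  proof -
    have "(1 / (1 + \<eta> / 2)) ^ n * ?V W = ?V D"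
      unfolding W_def using eta D
      by (intro measure_vol_affine) (auto simp: in_carrier_iff)
    then show ?thesis
      using eta by (simp add: power_divide field_simps)
  qed
  have VB: "?V (B x) = ?V D / (2 / \<eta>) ^ n" if "x \<in> X" for x
  proof -
    have "(2 / \<eta>) ^ n * ?V (B x) = ?V D"
      unfolding B_def using eta D carrier[of x] X that
      by (intro measure_vol_affine) (auto simp: in_carrier_iff)
    then show ?thesis
      using eta by (simp add: field_simps)
  qed
  have BW: "B x \<subseteq> W" if "x \<in> X" for x
  proof
    fix z assume "z \<in> B x"
    then have d: "(- (2 / \<eta>)) *\<^sub>R x + (2 / \<eta>) *\<^sub>R z \<in> D" (is "?d \<in> D")
      by (simp add: B_def)
    have "(1 / (1 + \<eta> / 2)) *\<^sub>R x + ((\<eta> / 2) / (1 + \<eta> / 2)) *\<^sub>R ?d \<in> D"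
      using D d X that eta
      by (intro convex_symmetric_combination[OF D(2,3) _ d]) (auto simp: field_simps)
    also have "(1 / (1 + \<eta> / 2)) *\<^sub>R x + ((\<eta> / 2) / (1 + \<eta> / 2)) *\<^sub>R ?d
        = (1 / (1 + \<eta> / 2)) *\<^sub>R z"
      using eta by (auto simp: fun_eq_iff field_simps)
    finally show "z \<in> W"
      by (simp add: W_def scaleR_fun_def)
  qed
  have disj: "disjoint_family_on B X"
    unfolding disjoint_family_on_def
  proof (intro ballI impI)
    fix x y assume xy: "x \<in> X" "y \<in> X" "x \<noteq> y"
    show "B x \<inter> B y = {}"
    proof (rule ccontr)
      assume "B x \<inter> B y \<noteq> {}"
      then obtain z where z: "(- (2 / \<eta>)) *\<^sub>R x + (2 / \<eta>) *\<^sub>R z \<in> D" (is "?a \<in> D")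
          "(- (2 / \<eta>)) *\<^sub>R y + (2 / \<eta>) *\<^sub>R z \<in> D" (is "?b \<in> D")
        by (auto simp: B_def)
      have "(- (1 / 2)) *\<^sub>R ?a + (1 / 2) *\<^sub>R ?b \<in> D"
        using z by (intro convex_symmetric_combination[OF D(2,3) z]) auto
      also have "(- (1 / 2)) *\<^sub>R ?a + (1 / 2) *\<^sub>R ?b = (1 / \<eta>) *\<^sub>R (x - y)"
        using eta by (auto simp: fun_eq_iff field_simps)
      finally show False
        using sep[OF xy] by (simp add: scaleR_fun_def)
    qed
  qed
  have "W \<subseteq> cube n ((1 + \<eta> / 2) * r)"
  proof
    fix z assume "z \<in> W"
    then have *: "(1 / (1 + \<eta> / 2)) *\<^sub>R z \<in> cube n r"
      using bounds by (auto simp: W_def)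
    then show "z \<in> cube n ((1 + \<eta> / 2) * r)"
      using eta by (auto simp: cube_def in_carrier_iff abs_mult divide_le_eq mult.commute)
  qed
  then have fW: "W \<in> fmeasurable (vol n)"
    by (intro fmeasurable_vol BW_sets)
  have fB: "B x \<in> fmeasurable (vol n)" if "x \<in> X" for x
    using BW_sets by (intro fmeasurableI2[OF fW BW[OF that]]) simp
  have "real (card X) * (?V D / (2 / \<eta>) ^ n) = (\<Sum>x\<in>X. ?V (B x))"
    using VB by simp
  also have "\<dots> = ?V (\<Union>x\<in>X. B x)"
    using X disj BW_sets fB
    by (intro measure_finite_Union[symmetric]) (auto simp: fmeasurable_def less_top)
  also have "\<dots> \<le> ?V W"
    using BW fW BW_sets X by (intro measure_mono_fmeasurable) auto
  finally have "real (card X) * (?V D / (2 / \<eta>) ^ n) \<le> (1 + \<eta> / 2) ^ n * ?V D"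
    unfolding VW .
  then have "real (card X) \<le> (1 + \<eta> / 2) ^ n * (2 / \<eta>) ^ n"
    using V eta by (simp add: field_simps)
  also have "\<dots> = (1 + 2 / \<eta>) ^ n"
  proof -
    have "(1 + \<eta> / 2) * (2 / \<eta>) = 1 + 2 / \<eta>"
      using eta by (simp add: field_simps)
    then show ?thesis
      by (simp flip: power_mult_distrib)
  qed
  finally show ?thesis .
qed

text \<open>
  A bound on the size of separated sets yields a net: a separated set of largest size cannot be
  extended.
\<close>

lemma maximal_separated_subset:
  assumes sym: "\<And>x y. Q x y \<Longrightarrow> Q y x"
    and bound: "\<And>X. finite X \<Longrightarrow> X \<subseteq> T \<Longrightarrow> pairwise Q X \<Longrightarrow> real (card X) \<le> N"
  obtains X where "finite X" "X \<subseteq> T" "pairwise Q X" "\<And>t. t \<in> T \<Longrightarrow> \<exists>x\<in>X. t = x \<or> \<not> Q t x"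
proof -
  let ?P = "\<lambda>X. finite X \<and> X \<subseteq> T \<and> pairwise Q X"
  have "\<exists>X. ?P X \<and> (\<forall>Y. ?P Y \<longrightarrow> card Y \<le> card X)"
  proof (rule ex_has_greatest_nat)
    show "?P {}" by simp
    show "\<forall>X. ?P X \<longrightarrow> card X < Suc (nat \<lfloor>N\<rfloor>)"
      using bound by (auto simp: less_Suc_eq_le le_nat_floor)
  qed
  then obtain X where X: "?P X" and max: "\<And>Y. ?P Y \<Longrightarrow> card Y \<le> card X"
    by blast
  have "\<exists>x\<in>X. t = x \<or> \<not> Q t x" if t: "t \<in> T" for t
  proof (rule ccontr)
    assume "\<not> ?thesis"
    then have "t \<notin> X" "\<forall>x\<in>X. Q t x" by auto
    moreover from this have "?P (insert t X)"
      using X t sym by (auto simp: pairwise_insert)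
    ultimately show False
      using max[of "insert t X"] X by simp
  qed
  with X that show ?thesis by blast
qed

section \<open>Quotients of the coordinate space by a subspace\<close>

definition unit_vec :: "nat \<Rightarrow> nat \<Rightarrow> real"
  where "unit_vec j = (\<lambda>i. if i = j then 1 else 0)"

lemma sum_fun_apply: "(\<Sum>a\<in>A. f a) i = (\<Sum>a\<in>A. f a i :: real)"
  by (induction A rule: infinite_finite_induct) auto

lemma unit_vec_expansion:
  assumes "x \<in> euclidean_carrier n"
  shows "x = (\<Sum>j<n. x j *\<^sub>R unit_vec j)"
proof
  fix i
  have "(\<Sum>j<n. x j *\<^sub>R unit_vec j) i = (\<Sum>j<n. if j = i then x j else 0)"
    unfolding sum_fun_apply by (intro sum.cong) (auto simp: unit_vec_def)
  then show "x i = (\<Sum>j<n. x j *\<^sub>R unit_vec j) i"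
    using assms by (simp add: in_carrier_iff)
qed

lemma inj_unit_vec: "inj unit_vec"
proof (rule injI)
  fix i j assume "unit_vec i = unit_vec j"
  then show "i = j"
    by (metis unit_vec_def zero_neq_one)
qed

lemma span_unit_vecs: "span (unit_vec ` {..<n}) = euclidean_carrier n"
proof
  show "span (unit_vec ` {..<n}) \<subseteq> euclidean_carrier n"
    by (rule span_minimal[OF _ subspace_carrier]) (auto simp: in_carrier_iff unit_vec_def)
  show "euclidean_carrier n \<subseteq> span (unit_vec ` {..<n})"
  proof
    fix x assume "x \<in> euclidean_carrier n"
    then have "x = (\<Sum>j<n. x j *\<^sub>R unit_vec j)"
      by (rule unit_vec_expansion)
    also have "\<dots> \<in> span (unit_vec ` {..<n})"
      by (intro span_sum span_scale span_base) auto
    finally show "x \<in> span (unit_vec ` {..<n})" .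
  qed
qed

lemma independent_unit_vecs: "independent (unit_vec ` {..<n})"
proof -
  have "u v = 0" if "(\<Sum>v\<in>unit_vec ` {..<n}. u v *\<^sub>R v) = 0" and v: "v \<in> unit_vec ` {..<n}" for u v
  proof -
    obtain j where j: "j < n" "v = unit_vec j" using v by auto
    have "0 = (\<Sum>v\<in>unit_vec ` {..<n}. u v *\<^sub>R v) j"
      using that by simp
    also have "\<dots> = (\<Sum>i<n. u (unit_vec i) *\<^sub>R unit_vec i) j"
      by (subst sum.reindex) (auto intro: inj_on_subset[OF inj_unit_vec])
    also have "\<dots> = (\<Sum>i<n. if i = j then u (unit_vec i) else 0)"
      unfolding sum_fun_apply by (intro sum.cong) (auto simp: unit_vec_def)
    finally show ?thesis using j by simp
  qed
  then show ?thesis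
    by (intro independent_if_scalars_zero) auto
qed

text \<open>
  Extending a basis of \<open>E\<close> to one of \<open>\<real>\<^sup>n\<close> by vectors \<open>b 0, b 1, \<dots>\<close>, the coordinates with respect to
  the new vectors give a linear map onto \<open>\<real>\<^bsup>n-d\<^esup>\<close> with kernel \<open>E\<close>. The vectors \<open>b\<close> are part of the
  conclusion because they define a right inverse, which shows that images of bodies have interior
  points.
\<close>

lemma linear_quotient_map:
  assumes "is_subspace_of_dim n d E"
  obtains P :: "(nat \<Rightarrow> real) \<Rightarrow> nat \<Rightarrow> real" and b
  where "d \<le> n" "linear P" "continuous_on UNIV P"
    "\<And>x. P x \<in> euclidean_carrier (n - d)"
    "\<And>x. x \<in> euclidean_carrier n \<Longrightarrow> P x = 0 \<longleftrightarrow> x \<in> E"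
    "\<And>y. (\<Sum>i<n-d. y i *\<^sub>R b i) \<in> euclidean_carrier n"
    "\<And>y. y \<in> euclidean_carrier (n - d) \<Longrightarrow> P (\<Sum>i<n-d. y i *\<^sub>R b i) = y"
proof -
  let ?U = "unit_vec ` {..<n}"
  have E: "E \<subseteq> euclidean_carrier n" "subspace E" "dim E = d"
    using assms by (auto simp: is_subspace_of_dim_def)
  have cardU: "card ?U = n"
    by (subst card_image) (auto intro: inj_on_subset[OF inj_unit_vec])
  obtain B where B: "B \<subseteq> E" "independent B" "E \<subseteq> span B" "card B = d"
    using basis_exists[of E] E by metis
  have spanB: "span B = E"
    using span_minimal[OF B(1) E(2)] B(3) by blast
  obtain B' where B': "B \<subseteq> B'" "B' \<subseteq> euclidean_carrier n" "independent B'"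
      "euclidean_carrier n \<subseteq> span B'"
    using maximal_independent_subset_extend[of B "euclidean_carrier n"] B E by blast
  have spanB': "span B' = euclidean_carrier n"
    using span_minimal[OF B'(2) subspace_carrier] B'(4) by blast
  have finB': "finite B'" and "card B' \<le> n"
    using independent_span_bound[of ?U B'] B' cardU by (auto simp: span_unit_vecs)
  moreover have "n \<le> card B'"
    using independent_span_bound[OF finB' independent_unit_vecs[of n]] cardU B'(4) span_base[of _ ?U]
    by (auto simp: span_unit_vecs)
  ultimately have cardB': "card B' = n" by simp
  have finB: "finite B" using finB' B' finite_subset by blast
  have dn: "d \<le> n"
    using card_mono[OF finB' B'(1)] B cardB' by simp
  have "card (B' - B) = n - d"
    using card_Diff_subset[OF finB B'(1)] B cardB' by simp
  then obtain b where b: "bij_betw b {..<n - d} (B' - B)"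
    using ex_bij_betw_nat_finite[of "B' - B"] finB' by (auto simp: lessThan_atLeast0)
  have b_in: "b i \<in> B'" "b i \<notin> B" if "i < n - d" for i
    using b that by (auto simp: bij_betw_def)
  (* Outside of the span the representation is a default value, so P0 is linear on the carrier only. *)
  define P0 where "P0 x = (\<lambda>i. if i < n - d then representation B' x (b i) else 0)" for x
  (* P extrapolates P0 from the unit vectors and is linear and continuous everywhere. *)
  define P where "P x = (\<Sum>j<n. x j *\<^sub>R P0 (unit_vec j))" for x :: "nat \<Rightarrow> real"
  have in_span: "x \<in> span B'" if "x \<in> euclidean_carrier n" for x
    using that spanB' by simp
  have unit_in: "unit_vec j \<in> euclidean_carrier n" if "j < n" for j
    using that by (auto simp: in_carrier_iff unit_vec_def)
  have P: "P x = P0 x" if x: "x \<in> euclidean_carrier n" for x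
  proof
    fix i
    have "P0 x i = (\<Sum>j<n. x j * P0 (unit_vec j) i)"
    proof (cases "i < n - d")
      case True
      have "representation B' x = representation B' (\<Sum>j<n. x j *\<^sub>R unit_vec j)"
        using unit_vec_expansion[OF x] by simp
      also have "\<dots> = (\<lambda>v. \<Sum>j<n. representation B' (x j *\<^sub>R unit_vec j) v)"
        using B'(3) in_span unit_in by (intro representation_sum) (auto intro!: span_scale)
      also have "\<dots> = (\<lambda>v. \<Sum>j<n. x j * representation B' (unit_vec j) v)"
        using B'(3) in_span unit_in by (auto simp: representation_scale)
      finally show ?thesis using True by (simp add: P0_def)
    qed (simp add: P0_def)
    then show "P x i = P0 x i"
      by (simp add: P_def sum_fun_apply)
  qed
  have linP: "linear P"
    by (rule linearI) (auto simp: P_def sum.distrib scaleR_add_left scaleR_sum_right)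
  have contP: "continuous_on UNIV P"
  proof (rule continuous_on_coordinatewise_then_product)
    show "continuous_on UNIV (\<lambda>x. P x i)" for i
      unfolding P_def sum_fun_apply scaleR_fun_apply real_scaleR_def
      by (intro continuous_on_sum continuous_on_mult continuous_on_coord continuous_on_id continuous_on_const)
  qed
  have P_carrier: "P x \<in> euclidean_carrier (n - d)" for x
    unfolding P_def in_carrier_iff sum_fun_apply by (simp add: P0_def)
  have kernel: "P x = 0 \<longleftrightarrow> x \<in> E" if x: "x \<in> euclidean_carrier n" for x
  proof
    assume "P x = 0"
    then have "representation B' x (b i) = 0" if "i < n - d" for i
      using fun_cong[OF P[OF x], of i] that by (simp add: P0_def)
    then have *: "representation B' x v = 0" if "v \<in> b ` {..<n - d}" for v
      using that by blast
    have "{v. representation B' x v \<noteq> 0} \<subseteq> B"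
      using * representation_ne_zero[of B' x] bij_betw_imp_surj_on[OF b] by blast
    moreover have "x = (\<Sum>v | representation B' x v \<noteq> 0. representation B' x v *\<^sub>R v)"
      using sum_nonzero_representation_eq[OF B'(3) in_span[OF x]] by simp
    moreover have "(\<Sum>v | representation B' x v \<noteq> 0. representation B' x v *\<^sub>R v) \<in> span B"
      using calculation(1) by (intro span_sum span_scale span_base) auto
    ultimately show "x \<in> E" using spanB by simp
  next
    assume "x \<in> E"
    then have "representation B' x = representation B x"
      using representation_extend[OF B'(3) _ B'(1)] spanB by simp
    moreover have "representation B x (b i) = 0" if "i < n - d" for i
      using representation_ne_zero[of B x "b i"] b_in[OF that] by blast
    ultimately show "P x = 0"
      unfolding P[OF x] by (auto simp: P0_def fun_eq_iff)
  qed
  have J: "(\<Sum>i<n-d. y i *\<^sub>R b i) \<in> euclidean_carrier n" for y :: "nat \<Rightarrow> real"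
    using b_in B' by (intro subspace_sum[OF subspace_carrier] subspace_scale[OF subspace_carrier]) auto
  have PJ: "P (\<Sum>i<n-d. y i *\<^sub>R b i) = y" if y: "y \<in> euclidean_carrier (n - d)" for y
  proof -
    have "P (b i) = unit_vec i" if i: "i < n - d" for i
    proof -
      have "b j = b i \<longleftrightarrow> j = i" if "j < n - d" for j
        using b i that by (auto simp: bij_betw_def inj_on_def)
      then show ?thesis
        using b_in[OF i] B' i
        by (subst P) (auto simp: P0_def fun_eq_iff unit_vec_def representation_basis)
    qed
    then have "P (\<Sum>i<n-d. y i *\<^sub>R b i) = (\<Sum>i<n-d. y i *\<^sub>R unit_vec i)"
      by (simp add: linear_sum[OF linP] linear_cmul[OF linP])
    then show ?thesis
      using unit_vec_expansion[OF y] by simp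
  qed
  show thesis
    using that[OF dn linP contP P_carrier kernel J PJ] by blast
qed

section \<open>Covering a convex body with a bounded section\<close>

lemma compact_subset_cube:
  assumes "compact D" "D \<subseteq> euclidean_carrier n"
  obtains r where "D \<subseteq> cube n r"
proof -
  have "compact ((\<lambda>y. \<Sum>i<n. \<bar>y i\<bar>) ` D)"
    by (intro compact_continuous_image assms continuous_on_sum continuous_on_rabs
        continuous_on_coord continuous_on_id)
  then have "bounded ((\<lambda>y. \<Sum>i<n. \<bar>y i\<bar>) ` D)"
    by (rule compact_imp_bounded)
  then obtain r where r: "\<And>y. y \<in> D \<Longrightarrow> \<bar>\<Sum>i<n. \<bar>y i\<bar>\<bar> \<le> r"
    by (auto simp: bounded_iff)
  have "\<bar>y i\<bar> \<le> r" if "y \<in> D" "i < n" for y i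
    using member_le_sum[of i "{..<n}" "\<lambda>i. \<bar>y i\<bar>"] r[OF that(1)] that(2) by auto
  then have "D \<subseteq> cube n r"
    using assms(2) by (auto simp: cube_def)
  then show thesis
    by (rule that)
qed

lemma convex_bodyD:
  assumes "convex_body n K"
  shows "convex K" "compact K" "K \<subseteq> euclidean_carrier n"
  using assms
  by (auto simp: convex_body_def Euclidean_space_def compactin_subtopology euclidean_product_topology
      compactin_euclidean_iff)

text \<open>
  A cube around some point \<open>x\<^sub>0\<close> is contained in \<open>K\<close>, hence also the opposite cube around \<open>-x\<^sub>0\<close>, and
  the midpoints of opposite pairs fill a cube around the origin.
\<close>

lemma convex_body_contains_cube:
  assumes K: "convex_body n K" "symmetric_set K"
  obtains e where "e > 0" "cube n e \<subseteq> K"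
proof -
  obtain x0 where "x0 \<in> Euclidean_space n interior_of K"
    using K by (auto simp: convex_body_def)
  then obtain U where U: "openin (Euclidean_space n) U" "x0 \<in> U" "U \<subseteq> K"
    by (auto simp: interior_of_def)
  then obtain V where V: "openin (powertop_real UNIV) V" "U = V \<inter> euclidean_carrier n"
    by (auto simp: Euclidean_space_def openin_subtopology)
  have "x0 \<in> V" using U V by auto
  from product_topology_open_contains_basis[OF V(1) this]
  obtain X where X: "x0 \<in> Pi\<^sub>E UNIV X" "\<And>i. open (X i)" "Pi\<^sub>E UNIV X \<subseteq> V"
    by auto
  have "\<exists>e>0. \<forall>t. \<bar>t - x0 i\<bar> < e \<longrightarrow> t \<in> X i" for i
    using X(1,2) unfolding open_dist dist_real_def by (auto simp: PiE_def Pi_def)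
  then obtain e where e: "\<And>i. e i > 0" "\<And>i t. \<bar>t - x0 i\<bar> < e i \<Longrightarrow> t \<in> X i"
    by metis
  define d' where "d' = Min (insert 1 (e ` {..<n}))"
  have d'_pos: "d' > 0"
    unfolding d'_def using e(1) by (subst Min_gr_iff) auto
  define d where "d = d' / 2"
  have d_pos: "d > 0" using d'_pos by (simp add: d_def)
  have d_less: "d < e i" if "i < n" for i
  proof -
    have "d' \<le> e i"
      unfolding d'_def using that by (intro Min_le) auto
    then show ?thesis using d'_pos unfolding d_def by linarith
  qed
  have near: "x0 + z \<in> K" if z: "z \<in> cube n d" for z
  proof -
    have x0: "x0 \<in> euclidean_carrier n" using U V by auto
    have "(x0 + z) i \<in> X i" for i
    proof (rule e(2))
      show "\<bar>(x0 + z) i - x0 i\<bar> < e i"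
        using z d_less[of i] e(1)[of i] by (cases "i < n") (force simp: cube_def in_carrier_iff)+
    qed
    then have "x0 + z \<in> V" using X(3) by auto
    moreover have "x0 + z \<in> euclidean_carrier n"
      using x0 z by (auto simp: cube_def in_carrier_iff)
    ultimately show ?thesis using U V by auto
  qed
  have "z \<in> K" if z: "z \<in> cube n d" for z
  proof -
    have "- z \<in> cube n d" using z by (auto simp: cube_def in_carrier_iff)
    then have "(1/2) *\<^sub>R (x0 + z) + (-(1/2)) *\<^sub>R (x0 + - z) \<in> K"
      using near[of "-z"] near[OF z] convex_bodyD[OF K(1)] K(2)
      by (intro convex_symmetric_combination) auto
    moreover have "(1/2) *\<^sub>R (x0 + z) + (-(1/2)) *\<^sub>R (x0 + - z) = z"
      by (auto simp: fun_eq_iff field_simps)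
    ultimately show ?thesis by simp
  qed
  then show thesis using that[OF d_pos] by blast
qed

text \<open>
  Let \<open>K\<^sub>R\<close> be the part of \<open>K\<close> in the ball of radius \<open>R\<close> and \<open>P\<close> the quotient map by \<open>E\<close>. A maximal
  subset of \<open>T\<close> whose images are \<open>1/R\<close>-separated in the norm with unit ball \<open>P K\<^sub>R\<close> has at most
  \<open>(1 + 2R)\<^bsup>n-d\<^esup>\<close> points, as this norm lives on \<open>\<real>\<^bsup>n-d\<^esup>\<close>. It remains to see that points \<open>t\<close>, \<open>x\<close> of \<open>T\<close> with
  close images are close themselves: \<open>t - x\<close> and some \<open>k/R\<close> with \<open>k \<in> K\<^sub>R\<close> have the same image, so
  \<open>t - x - k/R\<close> lies in \<open>E\<close>, and in \<open>(2 + 1/R) K\<close> as well. There the bound on the section applies,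
  while \<open>k/R\<close> has norm at most \<open>1\<close>.
\<close>

lemma covering_by_section:
  assumes E: "is_subspace_of_dim n d E"
    and K: "convex_body n K" "symmetric_set K"
    and bounded_section: "\<And>x. x \<in> K \<inter> E \<Longrightarrow> enorm n x \<le> 1/2"
    and R: "R \<ge> 1" and T: "T \<subseteq> {x \<in> K. enorm n x \<le> R}"
  obtains X where "finite X" "X \<subseteq> T" "real (card X) \<le> (1 + 2 * R) ^ (n - d)"
    "\<And>t. t \<in> T \<Longrightarrow> \<exists>x\<in>X. enorm n (t - x) \<le> 3"
proof -
  note K' = convex_bodyD[OF K(1)]
  let ?m = "n - d"
  obtain P b where P: "d \<le> n" "linear P" "continuous_on UNIV P"
    "\<And>x. P x \<in> euclidean_carrier ?m"
    "\<And>x. x \<in> euclidean_carrier n \<Longrightarrow> P x = 0 \<longleftrightarrow> x \<in> E"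
    "\<And>y. (\<Sum>i<?m. y i *\<^sub>R b i) \<in> euclidean_carrier n"
    "\<And>y. y \<in> euclidean_carrier ?m \<Longrightarrow> P (\<Sum>i<?m. y i *\<^sub>R b i) = y"
    by (rule linear_quotient_map[OF E], rule that; assumption)
  define KR where "KR = {x \<in> K. enorm n x \<le> R}"
  have KR: "x \<in> K" "enorm n x \<le> R" "x \<in> euclidean_carrier n" if "x \<in> KR" for x
    using that K' by (auto simp: KR_def)
  have convKR: "convex KR"
  proof (rule convexI)
    fix x y and u v :: real
    assume *: "x \<in> KR" "y \<in> KR" "0 \<le> u" "0 \<le> v" "u + v = 1"
    have "enorm n (u *\<^sub>R x + v *\<^sub>R y) \<le> u * enorm n x + v * enorm n y"
      using enorm_triangle[of n "u *\<^sub>R x" "v *\<^sub>R y"] * by (simp add: enorm_scaleR)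
    also have "\<dots> \<le> u * R + v * R"
      using * KR by (intro add_mono mult_left_mono) auto
    also have "\<dots> = R" using * by (simp flip: distrib_right)
    finally have "enorm n (u *\<^sub>R x + v *\<^sub>R y) \<le> R" .
    moreover have "u *\<^sub>R x + v *\<^sub>R y \<in> K"
      using * KR(1) by (intro convexD[OF K'(1)])
    ultimately show "u *\<^sub>R x + v *\<^sub>R y \<in> KR"
      unfolding KR_def by blast
  qed
  have neg: "- x \<in> K" if "x \<in> K" for x
    using K(2) that unfolding symmetric_set_def by blast
  have negKR: "- x \<in> KR" if "x \<in> KR" for x
    using that neg by (auto simp: KR_def enorm_minus)
  then have symKR: "symmetric_set KR"
    unfolding symmetric_set_def by (force simp: image_iff)
  define D where "D = P ` KR"
  have "compact KR"
  proof -
    have "closed {x. enorm n x \<le> R}"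
      by (intro closed_Collect_le continuous_on_enorm continuous_on_id continuous_on_const)
    moreover have "KR = K \<inter> {x. enorm n x \<le> R}" by (auto simp: KR_def)
    ultimately show ?thesis using K'(2) by (simp add: compact_Int_closed)
  qed
  then have compD: "compact D"
    unfolding D_def by (intro compact_continuous_image continuous_on_subset[OF P(3)]) auto
  have D: "D \<in> sets borel" "convex D" "symmetric_set D"
  proof -
    show "D \<in> sets borel" using compD by (simp add: borel_compact)
    show "convex D" unfolding D_def using convKR P(2) by (rule convex_linear_image[rotated])
    show "symmetric_set D"
      unfolding symmetric_set_def D_def image_image linear_neg[OF P(2), symmetric]
      using symKR unfolding symmetric_set_def by (metis image_image)
  qed
  obtain r where r: "D \<subseteq> cube ?m r"
    using compact_subset_cube[OF compD] P(4) by (auto simp: D_def)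
  obtain e0 where e0: "e0 > 0" "cube n e0 \<subseteq> K"
    using convex_body_contains_cube[OF K] by blast
  (* The second bound puts the cube into the ball of radius R. *)
  define e where "e = min e0 (R / (real n + 1))"
  have e: "e > 0" using e0 R by (auto simp: e_def)
  have e_KR: "cube n e \<subseteq> KR"
  proof
    fix x assume x: "x \<in> cube n e"
    have "enorm n x \<le> (\<Sum>i<n. \<bar>x i\<bar>)" by (rule enorm_le_sum)
    also have "\<dots> \<le> (\<Sum>i<n. R / (real n + 1))"
      using x by (intro sum_mono) (auto simp: cube_def e_def)
    also have "\<dots> \<le> R" using R by (simp add: field_simps)
    finally show "x \<in> KR" using x e0 by (auto simp: KR_def cube_def e_def)
  qed
  (* The right inverse of P enlarges coordinates by a factor less than S. *)
  define S where "S = 1 + (\<Sum>i<?m. \<Sum>j<n. \<bar>b i j\<bar>)"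
  have S: "S > 0" unfolding S_def by (intro add_pos_nonneg sum_nonneg) auto
  have D_cube: "cube ?m (e / S) \<subseteq> D"
  proof
    fix y assume y: "y \<in> cube ?m (e / S)"
    let ?x = "\<Sum>i<?m. y i *\<^sub>R b i"
    have "\<bar>?x j\<bar> \<le> e" if j: "j < n" for j
    proof -
      have "\<bar>?x j\<bar> \<le> (\<Sum>i<?m. \<bar>y i * b i j\<bar>)"
        unfolding sum_fun_apply by (simp add: sum_abs)
      also have "\<dots> \<le> (\<Sum>i<?m. (e / S) * (\<Sum>j<n. \<bar>b i j\<bar>))"
        unfolding abs_mult using y e S j
        by (intro sum_mono mult_mono member_le_sum[of j "{..<n}" "\<lambda>j. \<bar>b _ j\<bar>"]) (auto simp: cube_def)
      also have "\<dots> = (e / S) * (S - 1)"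
        by (simp add: S_def sum_distrib_left)
      also have "\<dots> \<le> (e / S) * S" using e S by (intro mult_left_mono) auto
      finally show ?thesis using S by simp
    qed
    then have "?x \<in> cube n e" using P(6)[of y] by (simp add: cube_def)
    moreover have "P ?x = y" using P(7) y by (simp add: cube_def)
    ultimately show "y \<in> D" using e_KR unfolding D_def by (metis image_eqI subsetD)
  qed
  have TKR: "t \<in> KR" if "t \<in> T" for t using that T by (auto simp: KR_def)
  have zeroD: "0 \<in> D" using D_cube e S by (auto simp: cube_def in_carrier_iff)
  define Q where "Q x y \<longleftrightarrow> R *\<^sub>R (P x - P y) \<notin> D" for x y
  have Q_sym: "Q y x" if "Q x y" for x y
  proof -
    have "R *\<^sub>R (P x - P y) = (-1) *\<^sub>R (R *\<^sub>R (P y - P x))"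
      by (simp add: scaleR_diff_right)
    then show ?thesis
      using that convex_symmetric_scale[OF D(2,3), of "R *\<^sub>R (P y - P x)" "-1"] by (auto simp: Q_def)
  qed
  have Q_bound: "real (card X) \<le> (1 + 2 * R) ^ ?m" if X: "finite X" "X \<subseteq> T" "pairwise Q X" for X
  proof -
    have "inj_on P X"
    proof (rule inj_onI, rule ccontr)
      fix x y assume *: "x \<in> X" "y \<in> X" "P x = P y" "x \<noteq> y"
      then have "Q x y" using X(3) by (auto simp: pairwise_def)
      then show False using * zeroD by (simp add: Q_def)
    qed
    moreover have "real (card (P ` X)) \<le> (1 + 2 / (1 / R)) ^ ?m"
    proof (rule card_separated_le[OF D r D_cube])
      show "P ` X \<subseteq> D" using X(2) TKR by (auto simp: D_def)
      show "(1 / (1 / R)) *\<^sub>R (x - y) \<notin> D" if "x \<in> P ` X" "y \<in> P ` X" "x \<noteq> y" for x y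
        using that X(3) by (auto simp: pairwise_def Q_def)
    qed (use e S R X in auto)
    ultimately show ?thesis by (simp add: card_image)
  qed
  obtain X where X: "finite X" "X \<subseteq> T" "pairwise Q X" "\<And>t. t \<in> T \<Longrightarrow> \<exists>x\<in>X. t = x \<or> \<not> Q t x"
    using maximal_separated_subset[of Q T] Q_sym Q_bound by metis
  have close: "enorm n (t - x) \<le> 3" if t: "t \<in> T" and x: "x \<in> T" and "\<not> Q t x" for t x
  proof -
    obtain k where k: "k \<in> KR" "R *\<^sub>R (P t - P x) = P k"
      using \<open>\<not> Q t x\<close> by (auto simp: Q_def D_def)
    define c where "c = (1/2) *\<^sub>R t + (-(1/2)) *\<^sub>R x"
    have c: "c \<in> K"
      unfolding c_def using KR TKR t x K' K(2)
      by (intro convex_symmetric_combination) auto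
    define s where "s = 2 + 1 / R"
    have s: "s > 0" "s \<le> 3" using R by (auto simp: s_def field_simps)
    define w where "w = (2 / s) *\<^sub>R c + (- (1 / R / s)) *\<^sub>R k"
    have w: "w \<in> K"
      unfolding w_def using c k KR K' K(2) R s
      by (intro convex_symmetric_combination) (auto simp: s_def abs_mult field_simps)
    have sw: "s *\<^sub>R w = t - x - (1 / R) *\<^sub>R k"
      using s(1) by (auto simp: w_def c_def fun_eq_iff field_simps)
    have "s *\<^sub>R P w = P (s *\<^sub>R w)"
      by (simp only: linear_cmul[OF P(2)])
    also have "\<dots> = P t - P x - (1 / R) *\<^sub>R P k"
      unfolding sw by (simp only: linear_diff[OF P(2)] linear_cmul[OF P(2)])
    also have "\<dots> = 0"
      unfolding k(2)[symmetric] using R by simp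
    finally have "P w = 0" using s by simp
    then have "w \<in> K \<inter> E" using P(5)[of w] w K'(3) by auto
    then have "enorm n w \<le> 1/2" by (rule bounded_section)
    have "t - x = s *\<^sub>R w + (1 / R) *\<^sub>R k" using sw by simp
    then have "enorm n (t - x) \<le> enorm n (s *\<^sub>R w) + enorm n ((1 / R) *\<^sub>R k)"
      using enorm_triangle[of n "s *\<^sub>R w" "(1 / R) *\<^sub>R k"] by (simp only:)
    also have "\<dots> = s * enorm n w + enorm n k / R"
      using s R by (simp add: enorm_scaleR)
    also have "\<dots> \<le> 3 * (1 / 2) + 1"
      using \<open>enorm n w \<le> 1/2\<close> s R KR(2)[OF k(1)] by (intro add_mono mult_mono) auto
    finally show ?thesis by simp
  qed
  have "\<exists>x\<in>X. enorm n (t - x) \<le> 3" if "t \<in> T" for t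
  proof -
    from X(4)[OF that] obtain x where "x \<in> X" "t = x \<or> \<not> Q t x" by blast
    then show ?thesis using close[OF that, of x] X(2) by (intro bexI[of _ x]) auto
  qed
  with X Q_bound[OF X(1-3)] that show thesis by blast
qed

section \<open>Random rotations of a point\<close>

lemma mat_vec_diff: "mat_vec n U (x - y) = mat_vec n U x - mat_vec n U y"
  by (simp add: mat_vec_def fun_eq_iff right_diff_distrib sum_subtractf)

lemma mat_vec_scaleR: "mat_vec n U (c *\<^sub>R x) = c *\<^sub>R mat_vec n U x"
  by (simp add: mat_vec_def fun_eq_iff sum_distrib_left mult.left_commute)

lemma mat_vec_mat_mult: "mat_vec n (mat_mult n A U) x = mat_vec n A (mat_vec n U x)"
proof
  fix i
  have "mat_vec n (mat_mult n A U) x i = (\<Sum>j<n. \<Sum>l<n. A i l * U l j * x j)"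
    by (simp add: mat_vec_def mat_mult_def sum_distrib_right)
  also have "\<dots> = (\<Sum>l<n. \<Sum>j<n. A i l * U l j * x j)"
    by (rule sum.swap)
  finally show "mat_vec n (mat_mult n A U) x i = mat_vec n A (mat_vec n U x) i"
    by (simp add: mat_vec_def sum_distrib_left mult.assoc)
qed

lemma enorm_mat_vec:
  assumes "U \<in> orthogonal_group n"
  shows "enorm n (mat_vec n U x) = enorm n x"
proof -
  have UU: "(\<Sum>l<n. U l i * U l j) = mat_one n i j" for i j
    using assms by (auto simp: orthogonal_group_def mat_mult_def fun_eq_iff)
  have "(enorm n (mat_vec n U x))\<^sup>2 = (\<Sum>l<n. (\<Sum>i<n. U l i * x i) * (\<Sum>j<n. U l j * x j))"
    unfolding enorm_sq by (simp add: mat_vec_def power2_eq_square)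
  also have "\<dots> = (\<Sum>l<n. \<Sum>i<n. \<Sum>j<n. (x i * x j) * (U l i * U l j))"
    by (simp add: sum_product mult_ac)
  also have "\<dots> = (\<Sum>i<n. \<Sum>l<n. \<Sum>j<n. (x i * x j) * (U l i * U l j))"
    by (rule sum.swap)
  also have "\<dots> = (\<Sum>i<n. \<Sum>j<n. \<Sum>l<n. (x i * x j) * (U l i * U l j))"
    by (intro sum.cong refl sum.swap)
  also have "\<dots> = (\<Sum>i<n. \<Sum>j<n. (x i * x j) * mat_one n i j)"
    by (simp flip: sum_distrib_left add: UU)
  also have "\<dots> = (\<Sum>i<n. \<Sum>j<n. if i = j then x i * x j else 0)"
    by (intro sum.cong) (auto simp: mat_one_def)
  also have "\<dots> = (enorm n x)\<^sup>2"
    unfolding enorm_sq by (simp add: power2_eq_square)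
  finally show ?thesis
    by (simp add: power2_eq_iff_nonneg)
qed

text \<open>
  The reflection in the hyperplane orthogonal to \<open>x - y\<close> exchanges \<open>x\<close> and \<open>y\<close>.
\<close>

lemma orthogonal_transitive:
  assumes x: "x \<in> euclidean_carrier n" and y: "y \<in> euclidean_carrier n"
    and eq: "enorm n x = enorm n y"
  obtains A where "A \<in> orthogonal_group n" "mat_vec n A x = y"
proof -
  define v where "v = x - y"
  define s where "s = (\<Sum>l<n. (v l)\<^sup>2)"
  define c where "c = 2 / s"
  (* For x = y both s and c are 0, and A is the identity. *)
  have c: "c * c * s = 2 * c" by (simp add: c_def)
  define A where "A i j = mat_one n i j - c * (v i * v j)" for i j
  have v0: "v i = 0" if "i \<ge> n" for i
    using x y that by (simp add: v_def in_carrier_iff)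
  have s0: "v i = 0" if "s = 0" for i
  proof (cases "i < n")
    case True
    have "\<forall>l\<in>{..<n}. (v l)\<^sup>2 = 0"
      using that unfolding s_def by (subst (asm) sum_nonneg_eq_0_iff) auto
    then show ?thesis using True by simp
  qed (simp add: v0)
  have "(\<Sum>l<n. A l i * A l j) = mat_one n i j" for i j
  proof (cases "i < n \<and> j < n")
    case True
    have "(\<Sum>l<n. A l i * A l j)
        = (\<Sum>l<n. (if l = i then mat_one n i j else 0) - (if l = i then c * (v i * v j) else 0)
            - (if l = j then c * (v i * v j) else 0) + c * c * (v i * v j) * (v l)\<^sup>2)"
      using True by (intro sum.cong) (auto simp: A_def mat_one_def algebra_simps power2_eq_square)
    also have "\<dots> = mat_one n i j - c * (v i * v j) - c * (v i * v j) + c * c * (v i * v j) * s"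
      using True by (simp add: sum.distrib sum_subtractf s_def flip: sum_distrib_left)
    also have "\<dots> = mat_one n i j - 2 * c * (v i * v j) + (c * c * s) * (v i * v j)"
      by (simp add: algebra_simps)
    also have "\<dots> = mat_one n i j"
      unfolding c by simp
    finally show ?thesis .
  next
    case False
    then have "A l i = 0 \<or> A l j = 0" for l
      using v0 by (auto simp: A_def mat_one_def)
    then have "(\<Sum>l<n. A l i * A l j) = 0"
      by (intro sum.neutral) auto
    then show ?thesis using False by (auto simp: mat_one_def)
  qed
  then have AO: "A \<in> orthogonal_group n"
    using v0 by (auto simp: orthogonal_group_def square_matrices_def mat_mult_def fun_eq_iff A_def mat_one_def)
  have xy: "(\<Sum>l<n. (x l)\<^sup>2) = (\<Sum>l<n. (y l)\<^sup>2)"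
    using eq by (simp flip: enorm_sq)
  have "2 * (\<Sum>l<n. v l * x l) = (\<Sum>l<n. (v l)\<^sup>2 + (x l)\<^sup>2 - (y l)\<^sup>2)"
    unfolding sum_distrib_left by (intro sum.cong) (auto simp: v_def power2_eq_square algebra_simps)
  also have "\<dots> = s"
    using xy by (simp add: sum.distrib sum_subtractf s_def)
  finally have vx: "2 * (\<Sum>l<n. v l * x l) = s" .
  have "mat_vec n A x = y"
  proof
    fix i
    have "mat_vec n A x i = (\<Sum>j<n. (if j = i then x i else 0) - c * v i * (v j * x j))"
      unfolding mat_vec_def by (intro sum.cong) (auto simp: A_def mat_one_def algebra_simps)
    also have "\<dots> = x i - c * v i * (\<Sum>j<n. v j * x j)"
      using x by (simp add: sum_subtractf sum_distrib_left in_carrier_iff)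
    also have "\<dots> = x i - v i"
    proof (cases "s = 0")
      case False
      then have "c * (\<Sum>j<n. v j * x j) = 1"
        unfolding c_def vx[symmetric] by (simp add: field_simps)
      then show ?thesis by (simp add: mult_ac flip: mult.assoc)
    qed (simp add: s0)
    finally show "mat_vec n A x i = y i" by (simp add: v_def)
  qed
  with AO that show thesis by blast
qed

lemma continuous_mat_vec: "continuous_on UNIV (\<lambda>U. mat_vec n U x)"
  unfolding mat_vec_def
  by (intro continuous_on_coordinatewise_then_product continuous_intros
      continuous_on_product_coordinates
      continuous_on_product_then_coordinatewise[OF continuous_on_product_coordinates])

lemma haar_space:
  assumes "normalized_haar n M"
  shows "space M = orthogonal_group n"
proof -
  have "sets M = sets (restrict_space borel (orthogonal_group n))"
    using assms by (simp add: normalized_haar_def)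
  from sets_eq_imp_space_eq[OF this] show ?thesis
    by (simp add: space_restrict_space)
qed

lemma haar_sets:
  assumes "normalized_haar n M" "C \<in> sets borel"
  shows "{U \<in> orthogonal_group n. U \<in> C} \<in> sets M"
proof -
  have "sets M = (\<inter>) (orthogonal_group n) ` sets borel"
    using assms by (simp add: normalized_haar_def sets_restrict_space)
  moreover have "{U \<in> orthogonal_group n. U \<in> C} = orthogonal_group n \<inter> C" by auto
  ultimately show ?thesis using assms(2) by blast
qed

lemma continuous_on_fun_diff:
  fixes f :: "'a::topological_space \<Rightarrow> nat \<Rightarrow> real"
  assumes "continuous_on S f"
  shows "continuous_on S (\<lambda>x. f x - a)"
proof (rule continuous_on_coordinatewise_then_product)
  show "continuous_on S (\<lambda>x. (f x - a) i)" for i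
    using continuous_on_coord[OF assms, of i] by (simp add: continuous_on_diff)
qed

definition hit_event :: "nat \<Rightarrow> real \<Rightarrow> (nat \<Rightarrow> real) \<Rightarrow> (nat \<Rightarrow> real) \<Rightarrow> (nat \<Rightarrow> nat \<Rightarrow> real) set"
  where "hit_event n r x y = {U \<in> orthogonal_group n. enorm n (mat_vec n U x - y) \<le> r}"

lemma hit_event_sets:
  assumes "normalized_haar n M"
  shows "hit_event n r x y \<in> sets M"
proof -
  have "continuous_on UNIV (\<lambda>U. mat_vec n U x - y)"
    by (intro continuous_on_fun_diff continuous_mat_vec)
  then have "closed {U. enorm n (mat_vec n U x - y) \<le> r}"
    by (intro closed_Collect_le continuous_on_enorm continuous_on_const)
  from haar_sets[OF assms borel_closed[OF this]] show ?thesis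
    by (simp add: hit_event_def)
qed

text \<open>
  Left invariance of Haar measure: a point is hit by \<open>Ux\<close> with the same probability as its image under
  any orthogonal map.
\<close>

lemma measure_hit_event_invariant:
  assumes M: "normalized_haar n M" and A: "A \<in> orthogonal_group n"
  shows "measure M (hit_event n r x (mat_vec n A y)) = measure M (hit_event n r x y)"
proof -
  have sets: "sets M = sets (restrict_space borel (orthogonal_group n))"
    and inv: "distr M M (mat_mult n A) = M"
    using M A by (auto simp: normalized_haar_def)
  have "measure M (hit_event n r x (mat_vec n A y))
      = measure (distr M M (mat_mult n A)) (hit_event n r x (mat_vec n A y))"
    by (simp add: inv)
  also have "\<dots> = measure M (mat_mult n A -` hit_event n r x (mat_vec n A y) \<inter> space M)"
    by (rule measure_distr[OF measurable_mat_mult[OF sets A] hit_event_sets[OF M]])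
  also have "mat_mult n A -` hit_event n r x (mat_vec n A y) \<inter> space M = hit_event n r x y"
    unfolding haar_space[OF M] hit_event_def
    using mat_mult_orthogonal_group[OF A] enorm_mat_vec[OF A]
    by (auto simp: mat_vec_mat_mult simp flip: mat_vec_diff)
  finally show ?thesis .
qed

definition enorm_ball :: "nat \<Rightarrow> (nat \<Rightarrow> real) \<Rightarrow> real \<Rightarrow> (nat \<Rightarrow> real) set"
  where "enorm_ball n a r = {z \<in> euclidean_carrier n. enorm n (z - a) \<le> r}"

lemma enorm_ball_sets: "enorm_ball n a r \<in> sets borel"
proof -
  have "continuous_on UNIV (\<lambda>z. z - a)"
    by (intro continuous_on_fun_diff continuous_on_id)
  then have "closed {z. enorm n (z - a) \<le> r}"
    by (intro closed_Collect_le continuous_on_enorm continuous_on_const)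
  moreover have "enorm_ball n a r = euclidean_carrier n \<inter> {z. enorm n (z - a) \<le> r}"
    by (auto simp: enorm_ball_def)
  ultimately show ?thesis
    using sets.Int[OF measurable_carrier borel_closed] by metis
qed

lemma enorm_ball_subset_cube: "enorm_ball n 0 r \<subseteq> cube n r"
  by (auto simp: enorm_ball_def cube_def intro: order_trans[OF abs_coord_le_enorm])

lemma measure_enorm_ball_pos: "measure (vol n) (enorm_ball n 0 1) > 0"
proof (rule measure_vol_pos)
  show "enorm_ball n 0 1 \<in> fmeasurable (vol n)"
    using enorm_ball_sets enorm_ball_subset_cube by (rule fmeasurable_vol)
  show "cube n (1 / (real n + 1)) \<subseteq> enorm_ball n 0 1"
  proof
    fix x assume x: "x \<in> cube n (1 / (real n + 1))"
    have "enorm n x \<le> (\<Sum>i<n. \<bar>x i\<bar>)" by (rule enorm_le_sum)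
    also have "\<dots> \<le> (\<Sum>i<n. 1 / (real n + 1))"
      using x by (intro sum_mono) (auto simp: cube_def)
    also have "\<dots> \<le> 1" by (simp add: field_simps)
    finally show "x \<in> enorm_ball n 0 1" using x by (auto simp: enorm_ball_def cube_def)
  qed
qed auto

lemma measure_enorm_ball:
  assumes "a \<in> euclidean_carrier n" "r > 0"
  shows "measure (vol n) (enorm_ball n a r) = r ^ n * measure (vol n) (enorm_ball n 0 1)"
proof -
  let ?g = "\<lambda>z. (- (1 / r)) *\<^sub>R a + (1 / r) *\<^sub>R z"
  have g: "?g z = (1 / r) *\<^sub>R (z - a)" for z
    by (simp add: scaleR_diff_right)
  have "?g -` enorm_ball n 0 1 = enorm_ball n a r"
  proof (intro set_eqI)
    fix z
    have "?g z \<in> euclidean_carrier n \<longleftrightarrow> z \<in> euclidean_carrier n"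
      using assms by (auto simp: in_carrier_iff)
    moreover have "enorm n (?g z) \<le> 1 \<longleftrightarrow> enorm n (z - a) \<le> r"
      unfolding g enorm_scaleR using assms(2) by (simp add: field_simps)
    ultimately show "z \<in> ?g -` enorm_ball n 0 1 \<longleftrightarrow> z \<in> enorm_ball n a r"
      by (simp add: enorm_ball_def)
  qed
  moreover have "(1 / r) ^ n * measure (vol n) (?g -` enorm_ball n 0 1) = measure (vol n) (enorm_ball n 0 1)"
    using assms by (intro measure_vol_affine enorm_ball_sets) (auto simp: in_carrier_iff)
  ultimately show ?thesis
    using assms(2) by (simp add: power_divide field_simps)
qed

text \<open>
  Points whose norm is between \<open>R - 1\<close> and \<open>R\<close> are within \<open>1\<close> of the sphere, hence within \<open>13\<close> of the
  net, and the shell that they form has at least \<open>R\<^bsup>n-1\<^esup>\<close> times the volume of the unit ball.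
\<close>

lemma card_sphere_net:
  assumes n: "n \<ge> 1" and R: "R > 1" and X: "finite X" "X \<subseteq> euclidean_carrier n"
    and net: "\<And>t. t \<in> euclidean_carrier n \<Longrightarrow> enorm n t = R \<Longrightarrow> \<exists>x\<in>X. enorm n (t - x) \<le> 12"
  shows "R ^ (n - 1) \<le> real (card X) * 13 ^ n"
proof -
  let ?V = "measure (vol n)"
  have cover: "enorm_ball n 0 R \<subseteq> enorm_ball n 0 (R - 1) \<union> (\<Union>x\<in>X. enorm_ball n x 13)"
  proof
    fix z assume z: "z \<in> enorm_ball n 0 R"
    show "z \<in> enorm_ball n 0 (R - 1) \<union> (\<Union>x\<in>X. enorm_ball n x 13)"
    proof (cases "enorm n z \<le> R - 1")
      case True
      then show ?thesis using z by (auto simp: enorm_ball_def)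
    next
      case False
      then have pos: "enorm n z > 0" "enorm n z > R - 1" using R by auto
      define t where "t = (R / enorm n z) *\<^sub>R z"
      have "enorm n t = R" using R pos by (simp add: t_def enorm_scaleR)
      moreover have "t \<in> euclidean_carrier n" using z by (simp add: t_def enorm_ball_def in_carrier_iff)
      ultimately obtain x where x: "x \<in> X" "enorm n (t - x) \<le> 12" using net by blast
      have "z - t = (1 - R / enorm n z) *\<^sub>R z"
        by (simp add: t_def scaleR_diff_left)
      then have "enorm n (z - t) = \<bar>1 - R / enorm n z\<bar> * \<bar>enorm n z\<bar>"
        by (simp add: enorm_scaleR)
      also have "\<dots> = \<bar>enorm n z - R\<bar>"
      proof -
        have "(1 - R / enorm n z) * enorm n z = enorm n z - R"
          using pos by (simp add: field_simps)
        then show ?thesis by (simp only: abs_mult[symmetric])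
      qed
      also have "\<dots> \<le> 1" using pos z by (auto simp: enorm_ball_def)
      finally have "enorm n (z - x) \<le> 13"
        using enorm_triangle_sub[of n z x t] x by simp
      then show ?thesis using x z by (auto simp: enorm_ball_def)
    qed
  qed
  have fm: "enorm_ball n x 13 \<in> fmeasurable (vol n)" for x
  proof -
    have "enorm_ball n x 13 \<subseteq> cube n (13 + enorm n x)"
    proof
      fix z assume z: "z \<in> enorm_ball n x 13"
      then have "enorm n z \<le> 13 + enorm n x"
        using enorm_triangle[of n "z - x" x] by (auto simp: enorm_ball_def)
      then show "z \<in> cube n (13 + enorm n x)"
        using z enorm_ball_subset_cube[of n "13 + enorm n x"] by (auto simp: enorm_ball_def)
    qed
    with enorm_ball_sets show "enorm_ball n x 13 \<in> fmeasurable (vol n)" by (rule fmeasurable_vol)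
  qed
  have fm0: "enorm_ball n 0 r \<in> fmeasurable (vol n)" for r
    using enorm_ball_sets enorm_ball_subset_cube by (rule fmeasurable_vol)
  have zero: "0 \<in> euclidean_carrier n" by (simp add: in_carrier_iff)
  have "R ^ n * ?V (enorm_ball n 0 1) = ?V (enorm_ball n 0 R)"
    using measure_enorm_ball[OF zero, of R] R by simp
  also have "\<dots> \<le> ?V (enorm_ball n 0 (R - 1) \<union> (\<Union>x\<in>X. enorm_ball n x 13))"
    using cover fm fm0 X(1) enorm_ball_sets
    by (intro measure_mono_fmeasurable fmeasurable.Un fmeasurable.finite_UN) auto
  also have "\<dots> \<le> ?V (enorm_ball n 0 (R - 1)) + ?V (\<Union>x\<in>X. enorm_ball n x 13)"
    using X(1) fm fm0 enorm_ball_sets by (intro measure_Un_le) auto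
  also have "\<dots> \<le> ?V (enorm_ball n 0 (R - 1)) + (\<Sum>x\<in>X. ?V (enorm_ball n x 13))"
    using X(1) enorm_ball_sets by (intro add_left_mono measure_UNION_le) auto
  also have "(\<Sum>x\<in>X. ?V (enorm_ball n x 13)) = (\<Sum>x\<in>X. 13 ^ n * ?V (enorm_ball n 0 1))"
    using X(2) by (intro sum.cong refl measure_enorm_ball) auto
  also have "?V (enorm_ball n 0 (R - 1)) = (R - 1) ^ n * ?V (enorm_ball n 0 1)"
    using R by (intro measure_enorm_ball zero) auto
  also have "(R - 1) ^ n * ?V (enorm_ball n 0 1) + (\<Sum>x\<in>X. 13 ^ n * ?V (enorm_ball n 0 1))
      = ((R - 1) ^ n + real (card X) * 13 ^ n) * ?V (enorm_ball n 0 1)"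
    by (simp add: distrib_right)
  finally have "R ^ n * ?V (enorm_ball n 0 1)
      \<le> ((R - 1) ^ n + real (card X) * 13 ^ n) * ?V (enorm_ball n 0 1)" .
  then have "R ^ n \<le> (R - 1) ^ n + real (card X) * 13 ^ n"
    using measure_enorm_ball_pos[of n] by simp
  moreover have "R ^ (n - 1) + (R - 1) ^ n \<le> R ^ n"
  proof -
    obtain m where m: "n = Suc m" using n by (cases n) auto
    have "(R - 1) ^ n \<le> (R - 1) * R ^ m"
      using R unfolding m by (auto intro!: mult_left_mono power_mono)
    then show ?thesis by (simp add: m algebra_simps)
  qed
  ultimately show ?thesis by linarith
qed

text \<open>
  By invariance and transitivity, \<open>Ux\<close> is within \<open>6\<close> of \<open>z\<close> with the same probability \<open>p\<close> for all \<open>z\<close> of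
  norm \<open>R\<close>. For points at mutual distance more than \<open>12\<close> these events are disjoint, so \<open>p\<close> is at most the
  reciprocal of the size of such a set; a maximal one is a net of the sphere.
\<close>

lemma measure_hit_event_le:
  assumes M: "normalized_haar n M" and n: "n \<ge> 1" and R: "R > 1"
    and y: "y \<in> euclidean_carrier n" "enorm n y = R"
  shows "measure M (hit_event n 6 x y) \<le> 13 ^ n / R ^ (n - 1)"
proof (cases "measure M (hit_event n 6 x y) = 0")
  case True
  then show ?thesis using R by simp
next
  case False
  interpret prob_space M using M by (simp add: normalized_haar_def)
  define p where "p = measure M (hit_event n 6 x y)"
  have p: "p > 0" using False by (simp add: p_def zero_less_measure_iff)
  define T where "T = {z \<in> euclidean_carrier n. enorm n z = R}"
  have hit: "measure M (hit_event n 6 x z) = p" if "z \<in> T" for z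
  proof -
    have "z \<in> euclidean_carrier n" "enorm n y = enorm n z"
      using that y by (auto simp: T_def)
    from orthogonal_transitive[OF y(1) this]
    obtain A where "A \<in> orthogonal_group n" "mat_vec n A y = z" .
    then show ?thesis using measure_hit_event_invariant[OF M, of A 6 x y] by (simp add: p_def)
  qed
  define Q where "Q a b \<longleftrightarrow> enorm n (a - b) > 12" for a b
  have Q_sym: "Q b a" if "Q a b" for a b
    using that by (simp add: Q_def enorm_minus_commute)
  have card_p: "real (card X) * p \<le> 1" if X: "finite X" "X \<subseteq> T" "pairwise Q X" for X
  proof -
    have "disjoint_family_on (hit_event n 6 x) X"
      unfolding disjoint_family_on_def
    proof (intro ballI impI)
      fix a b assume ab: "a \<in> X" "b \<in> X" "a \<noteq> b"
      then have "enorm n (a - b) > 12" using X(3) by (auto simp: pairwise_def Q_def)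
      moreover have "enorm n (a - b) \<le> 12" if "U \<in> hit_event n 6 x a" "U \<in> hit_event n 6 x b" for U
        using that enorm_triangle_sub[of n a b "mat_vec n U x"]
          enorm_minus_commute[of n a "mat_vec n U x"] by (simp add: hit_event_def)
      ultimately show "hit_event n 6 x a \<inter> hit_event n 6 x b = {}"
        by force
    qed
    then have "(\<Sum>a\<in>X. measure M (hit_event n 6 x a)) = measure M (\<Union>a\<in>X. hit_event n 6 x a)"
      using X(1) hit_event_sets[OF M] by (intro finite_measure_finite_Union[symmetric]) auto
    also have "\<dots> \<le> 1" by simp
    finally show ?thesis using hit X(2) by (simp add: subset_iff)
  qed
  have card_bound: "real (card X) \<le> 1 / p" if "finite X" "X \<subseteq> T" "pairwise Q X" for X
    using card_p[OF that] p by (simp add: field_simps)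
  obtain X where X: "finite X" "X \<subseteq> T" "pairwise Q X" "\<And>t. t \<in> T \<Longrightarrow> \<exists>a\<in>X. t = a \<or> \<not> Q t a"
    using maximal_separated_subset[of Q T "1 / p"] Q_sym card_bound by blast
  have "R ^ (n - 1) \<le> real (card X) * 13 ^ n"
  proof (rule card_sphere_net[OF n R X(1)])
    show "X \<subseteq> euclidean_carrier n" using X(2) by (auto simp: T_def)
    show "\<exists>a\<in>X. enorm n (t - a) \<le> 12" if "t \<in> euclidean_carrier n" "enorm n t = R" for t
      using X(4)[of t] that by (force simp: T_def Q_def)
  qed
  then have "p * R ^ (n - 1) \<le> p * (real (card X) * 13 ^ n)"
    using p by simp
  also have "\<dots> = (real (card X) * p) * 13 ^ n" by simp
  also have "\<dots> \<le> 1 * 13 ^ n"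
    using card_p[OF X(1-3)] by (intro mult_right_mono) auto
  finally show ?thesis
    using R by (simp add: p_def field_simps)
qed

section \<open>The intersection of a body with a rotated body\<close>

lemma euclid_dist_eq: "euclid_dist n x y = enorm n (x - y)"
  by (simp add: euclid_dist_def enorm_def fun_diff_def)

lemma compact_enorm_bounded:
  assumes "compact K"
  obtains B where "\<And>x. x \<in> K \<Longrightarrow> enorm n x \<le> B"
proof -
  have "bounded (enorm n ` K)"
    by (intro compact_imp_bounded compact_continuous_image continuous_on_enorm continuous_on_id assms)
  then show thesis
    using that by (force simp: bounded_iff)
qed

text \<open>
  Both \<open>x\<close> and \<open>-x\<close> belong to \<open>S\<close>, so the diameter is twice the largest norm.
\<close>

lemma euclid_diameter_le_iff:
  assumes K: "compact K" and S: "S \<subseteq> K" and neg: "\<And>x. x \<in> S \<Longrightarrow> - x \<in> S" and r: "r \<ge> 0"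
  shows "euclid_diameter n S \<le> 2 * r \<longleftrightarrow> (\<forall>x\<in>S. enorm n x \<le> r)"
proof (cases "S = {}")
  case True
  then show ?thesis using r by (simp add: euclid_diameter_def)
next
  case False
  obtain B where B: "\<And>x. x \<in> K \<Longrightarrow> enorm n x \<le> B"
    using compact_enorm_bounded[OF K] by blast
  have tri: "enorm n (x - y) \<le> enorm n x + enorm n y" for x y
    using enorm_triangle[of n x "- y"] by (simp add: enorm_minus)
  have bdd: "bdd_above ((\<lambda>(x, y). euclid_dist n x y) ` (S \<times> S))"
  proof (rule bdd_aboveI2)
    fix p assume p: "p \<in> S \<times> S"
    then have "fst p \<in> K" "snd p \<in> K" using S by auto
    then show "(case p of (x, y) \<Rightarrow> euclid_dist n x y) \<le> B + B"
      using tri[of "fst p" "snd p"] B[of "fst p"] B[of "snd p"]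
      unfolding case_prod_beta euclid_dist_eq by linarith
  qed
  show ?thesis
  proof
    assume *: "euclid_diameter n S \<le> 2 * r"
    show "\<forall>x\<in>S. enorm n x \<le> r"
    proof
      fix x assume x: "x \<in> S"
      have "2 * enorm n x = enorm n (2 *\<^sub>R x)"
        by (simp add: enorm_scaleR)
      also have "2 *\<^sub>R x = x - (- x)" by (simp add: scaleR_2)
      finally have "2 * enorm n x = euclid_dist n x (- x)"
        by (simp only: euclid_dist_eq)
      also have "\<dots> \<le> euclid_diameter n S"
        using cSUP_upper[OF _ bdd, of "(x, - x)"] x neg[OF x] False by (simp add: euclid_diameter_def)
      finally show "enorm n x \<le> r" using * by simp
    qed
  next
    assume *: "\<forall>x\<in>S. enorm n x \<le> r"
    have "(SUP (x, y)\<in>S \<times> S. euclid_dist n x y) \<le> 2 * r"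
    proof (rule cSUP_least)
      fix p assume "p \<in> S \<times> S"
      then have "enorm n (fst p) \<le> r" "enorm n (snd p) \<le> r" using * by auto
      then show "(case p of (x, y) \<Rightarrow> euclid_dist n x y) \<le> 2 * r"
        using tri[of "fst p" "snd p"] unfolding case_prod_beta euclid_dist_eq by linarith
    qed (use False in auto)
    then show "euclid_diameter n S \<le> 2 * r" using False by (simp add: euclid_diameter_def)
  qed
qed

lemma symmetric_setD: "symmetric_set K \<Longrightarrow> x \<in> K \<Longrightarrow> - x \<in> K"
  unfolding symmetric_set_def by blast

lemma bounded_section_enorm:
  assumes K: "convex_body n K" "symmetric_set K"
    and S: "is_section n m K S" "euclid_diameter n S \<le> 1"
  obtains E where "is_subspace_of_dim n m E" "\<And>x. x \<in> K \<inter> E \<Longrightarrow> enorm n x \<le> 1/2"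
proof -
  obtain E where E: "is_subspace_of_dim n m E" "S = K \<inter> E"
    using S(1) by (auto simp: is_section_def)
  have "- x \<in> S" if "x \<in> S" for x
    using that E symmetric_setD[OF K(2)] subspace_neg[of E] by (auto simp: is_subspace_of_dim_def)
  then have "\<forall>x\<in>S. enorm n x \<le> 1/2"
    using euclid_diameter_le_iff[OF convex_bodyD(2)[OF K(1)], of S "1/2" n] E(2) S(2) by auto
  with E that show thesis by blast
qed

text \<open>
  Projection along a compact factor is a closed map. Below, the compact factor is a body, and the
  projection is to the space of matrices.
\<close>

lemma closed_projection_of_compact:
  fixes C :: "'b::topological_space set" and Z :: "('a::topological_space \<times> 'b) set"
  assumes "compact C" "closed Z"
  shows "closed {x. \<exists>y\<in>C. (x, y) \<in> Z}"
proof -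
  have "closed_map (prod_topology euclidean (top_of_set C)) euclidean (fst :: 'a \<times> 'b \<Rightarrow> 'a)"
    using assms(1)
    by (intro Abstract_Topological_Spaces.closed_map_fst)
      (simp add: compact_space_subtopology compactin_euclidean_iff)
  moreover have "prod_topology euclidean (top_of_set C) = top_of_set (UNIV \<times> C :: ('a \<times> 'b) set)"
    using prod_topology_subtopology(2)[of euclidean euclidean C] by simp
  moreover have "closedin (top_of_set (UNIV \<times> C)) (Z \<inter> UNIV \<times> C)"
    using assms(2) by (auto simp: closedin_closed)
  ultimately have "closedin euclidean (fst ` (Z \<inter> UNIV \<times> C))"
    by (simp add: closed_map_def)
  moreover have "fst ` (Z \<inter> UNIV \<times> C) = {x. \<exists>y\<in>C. (x, y) \<in> Z}"
    by force
  ultimately show ?thesis by simp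
qed

lemma continuous_on_mat_vec_pair:
  "continuous_on UNIV (\<lambda>p. mat_vec n (fst p) (snd p))"
proof (rule continuous_on_coordinatewise_then_product)
  fix i
  have "continuous_on UNIV (\<lambda>p :: (nat \<Rightarrow> nat \<Rightarrow> real) \<times> (nat \<Rightarrow> real). fst p i j)" for j
    by (rule continuous_on_product_then_coordinatewise, rule continuous_on_product_then_coordinatewise)
      (rule continuous_on_fst[OF continuous_on_id])
  moreover have "continuous_on UNIV (\<lambda>p :: (nat \<Rightarrow> nat \<Rightarrow> real) \<times> (nat \<Rightarrow> real). snd p j)" for j
    by (rule continuous_on_product_then_coordinatewise) (rule continuous_on_snd[OF continuous_on_id])
  ultimately show "continuous_on UNIV (\<lambda>p. mat_vec n (fst p) (snd p) i)"
    unfolding mat_vec_def by (intro continuous_on_sum continuous_on_mult)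
qed

text \<open>
  For symmetric bodies, the complement in the orthogonal group of the event that \<open>K \<inter> UL\<close> has diameter at most \<open>2r\<close>.
\<close>

definition long_vector_event ::
    "nat \<Rightarrow> (nat \<Rightarrow> real) set \<Rightarrow> (nat \<Rightarrow> real) set \<Rightarrow> real \<Rightarrow> (nat \<Rightarrow> nat \<Rightarrow> real) set"
  where "long_vector_event n K L r =
    {U \<in> orthogonal_group n. \<exists>x\<in>L. mat_vec n U x \<in> K \<and> enorm n x > r}"

text \<open>
  A countable union of closed sets: the condition \<open>enorm n x > r\<close> is replaced by
  \<open>enorm n x \<ge> r + 1/(j+1)\<close>, and for each \<open>j\<close> the quantifier over the compact set \<open>L\<close> is a projection.
\<close>

lemma long_vector_event_sets:
  assumes M: "normalized_haar n M" and K: "compact K" and L: "compact L"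
  shows "long_vector_event n K L r \<in> sets M"
proof -
  define B where "B j = {U. \<exists>x\<in>L. (U, x) \<in>
      {p. mat_vec n (fst p) (snd p) \<in> K \<and> r + 1 / real (Suc j) \<le> enorm n (snd p)}}" for j
  have "closed (B j)" for j
  proof -
    have "closed ((\<lambda>p. mat_vec n (fst p) (snd p)) -` K)"
      using closed_vimage[OF compact_imp_closed[OF K] continuous_on_mat_vec_pair] .
    moreover have "closed {p :: (nat \<Rightarrow> nat \<Rightarrow> real) \<times> (nat \<Rightarrow> real). r + 1 / real (Suc j) \<le> enorm n (snd p)}"
      by (intro closed_Collect_le continuous_on_enorm continuous_on_const continuous_on_snd continuous_on_id)
    ultimately have "closed {p. mat_vec n (fst p) (snd p) \<in> K \<and> r + 1 / real (Suc j) \<le> enorm n (snd p)}"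
      using closed_Int by (simp add: Collect_conj_eq vimage_def)
    then show ?thesis
      unfolding B_def by (rule closed_projection_of_compact[OF L])
  qed
  then have "(\<Union>j. B j) \<in> sets borel"
    by (intro sets.countable_UN) (auto intro: borel_closed)
  from haar_sets[OF M this]
  have "{U \<in> orthogonal_group n. U \<in> (\<Union>j. B j)} \<in> sets M" .
  moreover have "U \<in> (\<Union>j. B j) \<longleftrightarrow> (\<exists>x\<in>L. mat_vec n U x \<in> K \<and> enorm n x > r)" for U
  proof
    assume "U \<in> (\<Union>j. B j)"
    then obtain j x where x: "x \<in> L" "mat_vec n U x \<in> K" "r + 1 / real (Suc j) \<le> enorm n x"
      by (auto simp: B_def)
    moreover have "1 / real (Suc j) > 0" by simp
    ultimately have "enorm n x > r" by linarith
    with x show "\<exists>x\<in>L. mat_vec n U x \<in> K \<and> enorm n x > r" by blast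
  next
    assume "\<exists>x\<in>L. mat_vec n U x \<in> K \<and> enorm n x > r"
    then obtain x where x: "x \<in> L" "mat_vec n U x \<in> K" "enorm n x > r" by blast
    then obtain j where "inverse (real (Suc j)) < enorm n x - r"
      using reals_Archimedean[of "enorm n x - r"] by auto
    then have "r + 1 / real (Suc j) \<le> enorm n x"
      by (simp add: inverse_eq_divide)
    with x show "U \<in> (\<Union>j. B j)" by (auto simp: B_def)
  qed
  ultimately show ?thesis
    by (simp add: long_vector_event_def)
qed

text \<open>
  The union bound over pairs of net points. A long vector of \<open>K \<inter> UL\<close> is shrunk to length \<open>R\<close> and
  replaced by the nearest net points of \<open>L\<close> and \<open>K\<close>, at a cost of \<open>3\<close> each.
\<close>

lemma long_vector_event_prob:
  assumes M: "normalized_haar n M" and n: "n \<ge> 1" and R: "R > 1"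
    and K: "convex_body n K" "symmetric_set K" and L: "convex_body n L" "symmetric_set L"
    and E: "is_subspace_of_dim n d E" "\<And>x. x \<in> K \<inter> E \<Longrightarrow> enorm n x \<le> 1/2"
    and F: "is_subspace_of_dim n m F" "\<And>x. x \<in> L \<inter> F \<Longrightarrow> enorm n x \<le> 1/2"
  shows "measure M (long_vector_event n K L R)
    \<le> (1 + 2 * R) ^ (n - d) * (1 + 2 * R) ^ (n - m) * (13 ^ n / R ^ (n - 1))"
proof -
  interpret prob_space M using M by (simp add: normalized_haar_def)
  let ?TK = "{x \<in> K. enorm n x = R}" and ?TL = "{x \<in> L. enorm n x = R}"
  have R1: "R \<ge> 1" using R by simp
  have TK: "?TK \<subseteq> {x \<in> K. enorm n x \<le> R}" and TL: "?TL \<subseteq> {x \<in> L. enorm n x \<le> R}"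
    by auto
  obtain X where X: "finite X" "X \<subseteq> ?TK" "real (card X) \<le> (1 + 2 * R) ^ (n - d)"
    "\<And>t. t \<in> ?TK \<Longrightarrow> \<exists>x\<in>X. enorm n (t - x) \<le> 3"
    by (rule covering_by_section[OF E(1) K E(2) R1 TK], assumption, rule that; assumption)
  obtain Y where Y: "finite Y" "Y \<subseteq> ?TL" "real (card Y) \<le> (1 + 2 * R) ^ (n - m)"
    "\<And>t. t \<in> ?TL \<Longrightarrow> \<exists>x\<in>Y. enorm n (t - x) \<le> 3"
    by (rule covering_by_section[OF F(1) L F(2) R1 TL], assumption, rule that; assumption)
  have cover: "long_vector_event n K L R \<subseteq> (\<Union>(x, y)\<in>X \<times> Y. hit_event n 6 y x)"
  proof
    fix U assume "U \<in> long_vector_event n K L R"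
    then obtain z where U: "U \<in> orthogonal_group n" and z: "z \<in> L" "mat_vec n U z \<in> K" "enorm n z > R"
      by (auto simp: long_vector_event_def)
    define c where "c = R / enorm n z"
    have c: "0 \<le> c" "c \<le> 1" "c * enorm n z = R" using R z(3) by (auto simp: c_def)
    define t where "t = c *\<^sub>R z"
    have t: "t \<in> ?TL" "mat_vec n U t \<in> ?TK"
    proof -
      have norm: "enorm n t = R" using c by (simp add: t_def enorm_scaleR)
      have "t \<in> L"
        unfolding t_def using convex_bodyD(1)[OF L(1)] L(2) z(1) c by (intro convex_symmetric_scale) auto
      then show "t \<in> ?TL" using norm by simp
      have "mat_vec n U t \<in> K"
        unfolding t_def mat_vec_scaleR
        using convex_bodyD(1)[OF K(1)] K(2) z(2) c by (intro convex_symmetric_scale) auto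
      then show "mat_vec n U t \<in> ?TK" using norm enorm_mat_vec[OF U] by simp
    qed
    obtain x where x: "x \<in> X" "enorm n (mat_vec n U t - x) \<le> 3" using X(4)[OF t(2)] by blast
    obtain y where y: "y \<in> Y" "enorm n (t - y) \<le> 3" using Y(4)[OF t(1)] by blast
    have "enorm n (mat_vec n U y - mat_vec n U t) = enorm n (t - y)"
      by (simp add: enorm_mat_vec[OF U] enorm_minus_commute flip: mat_vec_diff)
    then have "enorm n (mat_vec n U y - x) \<le> 6"
      using enorm_triangle_sub[of n "mat_vec n U y" x "mat_vec n U t"] x y by simp
    then have "U \<in> hit_event n 6 y x" using U by (simp add: hit_event_def)
    then show "U \<in> (\<Union>(x, y)\<in>X \<times> Y. hit_event n 6 y x)" using x y by blast
  qed
  have hit: "measure M (hit_event n 6 y x) \<le> 13 ^ n / R ^ (n - 1)" if "x \<in> X" for x y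
    using that X(2) convex_bodyD(3)[OF K(1)] by (intro measure_hit_event_le[OF M n R]) auto
  have fin: "finite (X \<times> Y)" using X Y by simp
  have "measure M (long_vector_event n K L R) \<le> measure M (\<Union>p\<in>X \<times> Y. hit_event n 6 (snd p) (fst p))"
    using cover fin hit_event_sets[OF M]
    by (intro finite_measure_mono sets.finite_UN) (auto simp: case_prod_beta)
  also have "\<dots> \<le> (\<Sum>p\<in>X \<times> Y. measure M (hit_event n 6 (snd p) (fst p)))"
    using fin hit_event_sets[OF M] by (intro measure_UNION_le) auto
  also have "\<dots> \<le> (\<Sum>p\<in>X \<times> Y. 13 ^ n / R ^ (n - 1))"
    using hit by (intro sum_mono) auto
  also have "\<dots> = real (card X) * real (card Y) * (13 ^ n / R ^ (n - 1))"
    by (simp add: card_cartesian_product)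
  also have "\<dots> \<le> (1 + 2 * R) ^ (n - d) * (1 + 2 * R) ^ (n - m) * (13 ^ n / R ^ (n - 1))"
    using X(3) Y(3) R by (intro mult_right_mono mult_mono) auto
  finally show ?thesis .
qed

text \<open>
  The exponent of \<open>R\<close> is at most \<open>-k/2\<close> because \<open>k/4 + 1 \<le> k/2\<close> for \<open>k \<ge> 4\<close>. The remaining constant is
  \<open>3\<^sup>2 \<cdot> 13 = 117\<close>, and \<open>117/400 \<le> 1/3 \<le> 1/e\<close>.
\<close>

lemma covering_bound_le_exp:
  fixes n k d m :: nat
  assumes k: "4 \<le> k" "k \<le> d" "d \<le> n" and m: "m \<le> n" "real n - real k / 4 \<le> real m"
    and R: "R = 160000 powr (real n / real k)"
  shows "(1 + 2 * R) ^ (n - d) * (1 + 2 * R) ^ (n - m) * (13 ^ n / R ^ (n - 1)) \<le> exp (- real n)"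
proof -
  have R1: "R \<ge> 1" unfolding R by (rule ge_one_powr_ge_zero) auto
  define a where "a = (n - d) + (n - m)"
  have n: "n \<ge> 1" using k by simp
  have ra: "real a - real (n - 1) \<le> - real k / 2"
    using k m n by (simp add: a_def of_nat_diff)
  have a2: "a \<le> 2 * n" by (simp add: a_def)
  have "(1 + 2 * R) ^ (n - d) * (1 + 2 * R) ^ (n - m) = (1 + 2 * R) ^ a"
    by (simp add: a_def power_add)
  also have "\<dots> \<le> (3 * R) ^ a"
    using R1 by (intro power_mono) auto
  also have "\<dots> = 3 ^ a * R ^ a" by (simp add: power_mult_distrib)
  also have "\<dots> \<le> 3 ^ (2 * n) * R ^ a"
    using a2 R1 by (intro mult_right_mono power_increasing) auto
  finally have "(1 + 2 * R) ^ (n - d) * (1 + 2 * R) ^ (n - m) * (13 ^ n / R ^ (n - 1))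
      \<le> 3 ^ (2 * n) * R ^ a * (13 ^ n / R ^ (n - 1))"
    using R1 by (intro mult_right_mono) auto
  also have "\<dots> = 117 ^ n * (R ^ a / R ^ (n - 1))"
  proof -
    have "(3 :: real) ^ (2 * n) * 13 ^ n = 117 ^ n"
      by (simp add: power_mult flip: power_mult_distrib)
    then show ?thesis by simp
  qed
  also have "R ^ a / R ^ (n - 1) = R powr (real a - real (n - 1))"
    using R1 by (simp add: powr_diff powr_realpow)
  also have "117 ^ n * \<dots> \<le> 117 ^ n * R powr (- real k / 2)"
    using ra R1 by (intro mult_left_mono powr_mono) auto
  also have "R powr (- real k / 2) = (160000 powr (1/2)) powr (- real n)"
    using k unfolding R powr_powr by simp
  also have "(160000 :: real) powr (1/2) = 400"
    by (simp add: powr_half_sqrt real_sqrt_eq_iff[of 160000 "400\<^sup>2", symmetric] del: real_sqrt_eq_iff)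
  also have "117 ^ n * (400 :: real) powr (- real n) = (117 / 400) ^ n"
    by (simp add: powr_minus powr_realpow power_divide field_simps)
  also have "\<dots> \<le> exp (- 1) ^ n"
  proof (rule power_mono)
    have "exp 1 \<le> (3 :: real)" by (rule exp_le)
    then have "1 / 3 \<le> exp (- 1 :: real)"
      by (simp add: exp_minus field_simps)
    then show "117 / 400 \<le> exp (- 1 :: real)" by simp
  qed simp
  also have "\<dots> = exp (- real n)"
    by (simp flip: exp_of_nat_mult)
  finally show ?thesis .
qed

theorem theorem1p1:
  shows "\<exists>c C :: real. c > 0 \<and> C > 0 \<and>
    (\<forall>(n::nat) (k::nat). 1 \<le> k \<and> k \<le> n \<longrightarrow>
      (\<forall>K L :: (nat \<Rightarrow> real) set.
        convex_body n K \<and> symmetric_set K \<and> convex_body n L \<and> symmetric_set L \<and>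
        (\<exists>m S. k \<le> m \<and> is_section n m K S \<and> euclid_diameter n S \<le> 1) \<and>
        (\<exists>m S. real n - c * real k \<le> real m \<and> is_section n m L S \<and> euclid_diameter n S \<le> 1) \<longrightarrow>
        (\<forall>M. normalized_haar n M \<longrightarrow>
          measure M {U \<in> orthogonal_group n.
              euclid_diameter n (K \<inter> mat_vec n U ` L) \<le> C powr (real n / real k)}
            \<ge> 1 - exp (- real n))))"
proof (rule exI[of _ "1/4"], rule exI[of _ 320000], intro conjI allI impI)
  fix n k :: nat and K L :: "(nat \<Rightarrow> real) set" and M
  assume k: "1 \<le> k \<and> k \<le> n"
    and bodies: "convex_body n K \<and> symmetric_set K \<and> convex_body n L \<and> symmetric_set L \<and>
        (\<exists>m S. k \<le> m \<and> is_section n m K S \<and> euclid_diameter n S \<le> 1) \<and>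
        (\<exists>m S. real n - 1/4 * real k \<le> real m \<and> is_section n m L S \<and> euclid_diameter n S \<le> 1)"
    and M: "normalized_haar n M"
  interpret prob_space M using M by (simp add: normalized_haar_def)
  have K: "convex_body n K" "symmetric_set K" and L: "convex_body n L" "symmetric_set L"
    using bodies by auto
  obtain d SK where d: "k \<le> d" "is_section n d K SK" "euclid_diameter n SK \<le> 1"
    using bodies by blast
  obtain m SL where m: "real n - 1/4 * real k \<le> real m" "is_section n m L SL" "euclid_diameter n SL \<le> 1"
    using bodies by blast
  obtain E where E: "is_subspace_of_dim n d E" "\<And>x. x \<in> K \<inter> E \<Longrightarrow> enorm n x \<le> 1/2"
    using bounded_section_enorm[OF K d(2,3)] by blast
  obtain F where F: "is_subspace_of_dim n m F" "\<And>x. x \<in> L \<inter> F \<Longrightarrow> enorm n x \<le> 1/2"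
    using bounded_section_enorm[OF L m(2,3)] by blast
  have n: "n \<ge> 1" using k by simp
  define R where "R = 160000 powr (real n / real k)"
  define \<rho> where "\<rho> = 320000 powr (real n / real k) / 2"
  have nk: "real n / real k \<ge> 1" using k by simp
  have R: "R > 1" unfolding R_def using nk by (intro gr_one_powr) auto
  have R_le: "R \<le> \<rho>"
  proof -
    (* Doubling the radius is paid for by the factor 2 in the base 320000 = 2 * 160000. *)
    have "2 powr 1 \<le> (2 :: real) powr (real n / real k)" using nk by (intro powr_mono) auto
    then have "2 * R \<le> 2 powr (real n / real k) * R" using R by (intro mult_right_mono) auto
    also have "\<dots> = 320000 powr (real n / real k)"
      unfolding R_def by (simp flip: powr_mult)
    finally show ?thesis by (simp add: \<rho>_def)
  qed
  have good_iff: "euclid_diameter n (K \<inter> mat_vec n U ` L) \<le> 320000 powr (real n / real k)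
      \<longleftrightarrow> U \<notin> long_vector_event n K L \<rho>" if U: "U \<in> orthogonal_group n" for U
  proof -
    have "- x \<in> K \<inter> mat_vec n U ` L" if "x \<in> K \<inter> mat_vec n U ` L" for x
    proof -
      obtain z where z: "z \<in> L" "x = mat_vec n U z" using \<open>x \<in> _\<close> by blast
      have "- x = mat_vec n U (- z)" using mat_vec_scaleR[of n U "-1" z] z(2) by simp
      then show ?thesis using \<open>x \<in> _\<close> symmetric_setD[OF K(2)] symmetric_setD[OF L(2) z(1)] by blast
    qed
    then have "euclid_diameter n (K \<inter> mat_vec n U ` L) \<le> 2 * \<rho> \<longleftrightarrow>
        (\<forall>x\<in>K \<inter> mat_vec n U ` L. enorm n x \<le> \<rho>)"
      using R R_le by (intro euclid_diameter_le_iff[OF convex_bodyD(2)[OF K(1)]]) auto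
    also have "\<dots> \<longleftrightarrow> U \<notin> long_vector_event n K L \<rho>"
    proof -
      have "(\<forall>x\<in>K \<inter> mat_vec n U ` L. enorm n x \<le> \<rho>)
          \<longleftrightarrow> (\<forall>z\<in>L. mat_vec n U z \<in> K \<longrightarrow> enorm n (mat_vec n U z) \<le> \<rho>)"
        by blast
      then show ?thesis
        using U unfolding enorm_mat_vec[OF U] by (auto simp: long_vector_event_def not_less)
    qed
    finally show ?thesis by (simp add: \<rho>_def)
  qed
  have "measure M (long_vector_event n K L \<rho>) \<le> exp (- real n)"
  proof (cases "k < 4")
    case True
    then have "m \<ge> n" using m(1) by linarith
    obtain P :: "(nat \<Rightarrow> real) \<Rightarrow> nat \<Rightarrow> real" where P: "P x \<in> euclidean_carrier (n - m)"
      "x \<in> euclidean_carrier n \<Longrightarrow> P x = 0 \<longleftrightarrow> x \<in> F" for x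
      by (rule linear_quotient_map[OF F(1)]) blast
    (* The quotient by F is zero-dimensional. *)
    have "L \<subseteq> F"
    proof
      fix x assume "x \<in> L"
      then have "x \<in> euclidean_carrier n" using convex_bodyD(3)[OF L(1)] by blast
      moreover have "P x = 0"
        using P(1)[of x] \<open>m \<ge> n\<close> by (simp add: in_carrier_iff fun_eq_iff)
      ultimately show "x \<in> F" using P(2) by blast
    qed
    then have "long_vector_event n K L \<rho> = {}"
      using F(2) R R_le by (force simp: long_vector_event_def)
    then show ?thesis by simp
  next
    case False
    have "long_vector_event n K L \<rho> \<subseteq> long_vector_event n K L R"
      using R_le by (auto simp: long_vector_event_def intro: le_less_trans)
    then have "measure M (long_vector_event n K L \<rho>) \<le> measure M (long_vector_event n K L R)"
      using long_vector_event_sets[OF M] convex_bodyD(2) K(1) L(1) by (intro finite_measure_mono) auto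
    also have "\<dots> \<le> (1 + 2 * R) ^ (n - d) * (1 + 2 * R) ^ (n - m) * (13 ^ n / R ^ (n - 1))"
      by (rule long_vector_event_prob[OF M n R K L E F])
    also have "\<dots> \<le> exp (- real n)"
    proof (rule covering_bound_le_exp[OF _ d(1)])
      show "d \<le> n" by (rule linear_quotient_map[OF E(1)])
      show "m \<le> n" by (rule linear_quotient_map[OF F(1)])
    qed (use False m(1) in \<open>auto simp: R_def\<close>)
    finally show ?thesis .
  qed
  moreover have "{U \<in> orthogonal_group n. euclid_diameter n (K \<inter> mat_vec n U ` L) \<le> 320000 powr (real n / real k)}
      = space M - long_vector_event n K L \<rho>"
    unfolding haar_space[OF M] using good_iff by auto
  moreover have "long_vector_event n K L \<rho> \<in> sets M"
    using long_vector_event_sets[OF M] convex_bodyD(2) K(1) L(1) by blast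
  ultimately show "1 - exp (- real n) \<le> measure M {U \<in> orthogonal_group n.
      euclid_diameter n (K \<inter> mat_vec n U ` L) \<le> 320000 powr (real n / real k)}"
    by (simp add: prob_compl)
qed auto

end
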